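(* Let $(M,g)$ be a four-dimensional spacetime that solves the vacuum field equations of quadratic gravity $$\gamma'\left(R_{ab}-\tfrac12 R g_{ab}+\Lambda g_{ab}\right)-4\alpha' B_{ab}+2\beta'\left(R_{ab}-\tfrac14 R g_{ab}+g_{ab}\Box-\nabla_b\nabla_a\right)R=0,$$ with constants $\alpha',\beta',\gamma',\Lambda$. Suppose that its Ricci tensor has the form $$R_{ab}=\Lambda g_{ab}+\omega'\,\ell_a\ell_b,\qquad \omega'\neq 0,\qquad \ell^a\ell_a=0,$$ and that its Weyl tensor, of any Petrov type, is aligned with the Ricci tensor. Then $(M,g)$ is necessarily a Kundt spacetime.
   Context: $g$ is Lorentzian; $R_{ab}$, $R$, $C_{abcd}$ are the Ricci tensor, Ricci scalar and Weyl tensor; $\Box=g^{ab}\nabla_a\nabla_b$; $\ell$ is a null vector field and $\omega'$ a function. Bach tensor: $B_{ab}=(\nabla^c\nabla^d+\tfrac12 R^{cd})C_{acbd}$. Null frame: $\ell,n,m^{(2)},m^{(3)}$ with $\ell^a\ell_a=n^an_a=0$, $\ell^an_a=1$, $m^{(i)a}m^{(j)}_a=\delta_{ij}$, and all other scalar products zero. A frame component $q$ has boost weight $\mathrm b$ if $\hat q=\lambda^{\mathrm b}q$ under the boost $\hat\ell=\lambda\ell$, $\hat n=\lambda^{-1}n$, $\hat m^{(i)}=m^{(i)}$. The boost order of a tensor with respect to $\ell$ is the maximal boost weight of its nonvanishing frame components (it depends only on $\ell$). The Weyl tensor is aligned with the Ricci tensor when its boost order with respect to $\ell$ is at most $1$,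 i.e. all its frame components of boost weight $+2$ vanish. For a geodetic null vector field $\ell$, the optical matrix is $\rho_{ij}=\ell_{a;b}m^{(i)a}m^{(j)b}$, $i,j\in\{2,3\}$; its trace, trace-free symmetric part and antisymmetric part describe expansion, shear and twist. A Kundt spacetime is a spacetime admitting a geodetic null congruence with vanishing optical matrix, i.e. a nonexpanding, shearfree, twistfree geodetic null congruence.
   Formalization: The formal theorem additionally assumes that α' = 0 and γ' + 8β'Λ = 0 do not both hold; otherwise the field equations are vacuous for this Ricci form and Vaidya-(A)dS is a non-Kundt counterexample. *)

theory Defs
  imports "HOL-Analysis.Analysis"
begin

definition pdiff :: "4 \<Rightarrow> (real^4 \<Rightarrow> real) \<Rightarrow> real^4 \<Rightarrow> real" where
  "pdiff a f x = frechet_derivative f (at x) (axis a 1)"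

primrec Ck_on :: "nat \<Rightarrow> (real^4) set \<Rightarrow> (real^4 \<Rightarrow> real) \<Rightarrow> bool" where
  "Ck_on 0 S f \<longleftrightarrow> continuous_on S f"
| "Ck_on (Suc k) S f \<longleftrightarrow> (\<forall>x\<in>S. f differentiable (at x)) \<and> (\<forall>a. Ck_on k S (pdiff a f))"

text \<open>Only meaningful for open \<open>S\<close>, since the derivatives are two-sided.\<close>
definition smooth_on :: "(real^4) set \<Rightarrow> (real^4 \<Rightarrow> real) \<Rightarrow> bool" where
  "smooth_on S f \<longleftrightarrow> (\<forall>k. Ck_on k S f)"

text \<open>A chart is a pair of its domain \<open>U\<close>, a subset of the manifold, and its coordinate map
  (whose values outside \<open>U\<close> are irrelevant). The manifold is the whole type \<open>'p\<close>.\<close>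
type_synonym 'p chart = "'p set \<times> ('p \<Rightarrow> real^4)"

definition chart_image :: "'p chart \<Rightarrow> (real^4) set" where
  "chart_image c = snd c ` fst c"

definition chart_inv :: "'p chart \<Rightarrow> real^4 \<Rightarrow> 'p" where
  "chart_inv c = inv_into (fst c) (snd c)"

definition overlap :: "'p chart \<Rightarrow> 'p chart \<Rightarrow> (real^4) set" where
  "overlap c d = snd c ` (fst c \<inter> fst d)"

definition transition :: "'p chart \<Rightarrow> 'p chart \<Rightarrow> real^4 \<Rightarrow> real^4" where
  "transition c d x = snd d (chart_inv c x)"

definition smooth_4_manifold ::
    "('p::{t2_space,second_countable_topology}) chart set \<Rightarrow> bool" where
  "smooth_4_manifold A \<longleftrightarrow>
     (\<Union>c\<in>A. fst c) = UNIV \<and>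
     (\<forall>c\<in>A. open (fst c) \<and> open (chart_image c) \<and>
            homeomorphism (fst c) (chart_image c) (snd c) (chart_inv c)) \<and>
     (\<forall>c\<in>A. \<forall>d\<in>A. \<forall>a. smooth_on (overlap c d) (\<lambda>x. transition c d x $ a))"

text \<open>Tensor fields are given by their coordinate components in every chart of the atlas, as
  functions of the coordinates, subject to the tensor transformation law on overlaps.\<close>

definition smooth_scalar_field :: "'p chart set \<Rightarrow> ('p \<Rightarrow> real) \<Rightarrow> bool" where
  "smooth_scalar_field A f \<longleftrightarrow> (\<forall>c\<in>A. smooth_on (chart_image c) (\<lambda>x. f (chart_inv c x)))"

definition smooth_vector_field :: "'p chart set \<Rightarrow> ('p chart \<Rightarrow> real^4 \<Rightarrow> real^4) \<Rightarrow> bool" where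
  "smooth_vector_field A v \<longleftrightarrow>
     (\<forall>c\<in>A. \<forall>a. smooth_on (chart_image c) (\<lambda>x. v c x $ a)) \<and>
     (\<forall>c\<in>A. \<forall>d\<in>A. \<forall>x\<in>overlap c d.
        v d (transition c d x) = jacobian (transition c d) (at x) *v v c x)"

definition minkowski :: "real^4^4" where
  "minkowski = (\<chi> a b. if a \<noteq> b then 0 else if a = 0 then -1 else 1)"

definition lorentzian_form :: "real^4^4 \<Rightarrow> bool" where
  "lorentzian_form G \<longleftrightarrow> (\<exists>P. invertible P \<and> transpose P ** G ** P = minkowski)"

definition lorentzian_metric :: "'p chart set \<Rightarrow> ('p chart \<Rightarrow> real^4 \<Rightarrow> real^4^4) \<Rightarrow> bool" where
  "lorentzian_metric A g \<longleftrightarrow>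
     (\<forall>c\<in>A. \<forall>a b. smooth_on (chart_image c) (\<lambda>x. g c x $ a $ b)) \<and>
     (\<forall>c\<in>A. \<forall>x\<in>chart_image c. lorentzian_form (g c x)) \<and>
     (\<forall>c\<in>A. \<forall>d\<in>A. \<forall>x\<in>overlap c d.
        g c x = transpose (jacobian (transition c d) (at x)) ** g d (transition c d x)
                  ** jacobian (transition c d) (at x))"

definition spacetime_4 :: "('p::{t2_space,second_countable_topology}) chart set
    \<Rightarrow> ('p chart \<Rightarrow> real^4 \<Rightarrow> real^4^4) \<Rightarrow> bool" where
  "spacetime_4 A g \<longleftrightarrow> smooth_4_manifold A \<and> lorentzian_metric A g"


text \<open>\<open>G\<close> denotes the components of the metric in one chart, as functions of the coordinates.\<close>
type_synonym metric = "real^4 \<Rightarrow> real^4^4"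

text \<open>A covariant tensor field of rank \<open>r\<close> maps a list of \<open>r\<close> indices to a component function.\<close>
type_synonym ctensor = "4 list \<Rightarrow> real^4 \<Rightarrow> real"

definition ctensor0 :: "(real^4 \<Rightarrow> real) \<Rightarrow> ctensor" where
  "ctensor0 f is x = (case is of [] \<Rightarrow> f x | _ \<Rightarrow> 0)"

definition ctensor1 :: "(4 \<Rightarrow> real^4 \<Rightarrow> real) \<Rightarrow> ctensor" where
  "ctensor1 T is x = (case is of [a] \<Rightarrow> T a x | _ \<Rightarrow> 0)"

definition ctensor4 :: "(4 \<Rightarrow> 4 \<Rightarrow> 4 \<Rightarrow> 4 \<Rightarrow> real^4 \<Rightarrow> real) \<Rightarrow> ctensor" where
  "ctensor4 T is x = (case is of [a, b, c, d] \<Rightarrow> T a b c d x | _ \<Rightarrow> 0)"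

definition inv_metric :: "metric \<Rightarrow> 4 \<Rightarrow> 4 \<Rightarrow> real^4 \<Rightarrow> real" where
  "inv_metric G a b x = matrix_inv (G x) $ a $ b"

text \<open>\<open>christoffel G a b c\<close> is \<open>\<Gamma>\<close> with upper index \<open>a\<close> and lower indices \<open>b\<close>, \<open>c\<close>.\<close>
definition christoffel :: "metric \<Rightarrow> 4 \<Rightarrow> 4 \<Rightarrow> 4 \<Rightarrow> real^4 \<Rightarrow> real" where
  "christoffel G a b c x = 1/2 * (\<Sum>d\<in>UNIV. inv_metric G a d x *
     (pdiff b (\<lambda>y. G y $ d $ c) x + pdiff c (\<lambda>y. G y $ d $ b) x - pdiff d (\<lambda>y. G y $ b $ c) x))"

text \<open>The new index comes first: \<open>cov_deriv G T (e # is)\<close> is \<open>\<nabla>\<^sub>e\<close> applied to \<open>T\<close>, component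
  \<open>is\<close>. Hence \<open>cov_deriv G (cov_deriv G T) (e # f # is)\<close> is \<open>\<nabla>\<^sub>e \<nabla>\<^sub>f T\<close>.\<close>
definition cov_deriv :: "metric \<Rightarrow> ctensor \<Rightarrow> ctensor" where
  "cov_deriv G T es x = (case es of [] \<Rightarrow> 0
     | e # is \<Rightarrow> pdiff e (T is) x
         - (\<Sum>k<length is. \<Sum>d\<in>UNIV. christoffel G d e (is ! k) x * T (is[k := d]) x))"

text \<open>Curvature conventions: \<open>(\<nabla>\<^sub>c \<nabla>\<^sub>d - \<nabla>\<^sub>d \<nabla>\<^sub>c) v\<^sup>a = R\<^sup>a\<^sub>b\<^sub>c\<^sub>d v\<^sup>b\<close> and
  \<open>R\<^sub>b\<^sub>d = R\<^sup>a\<^sub>b\<^sub>a\<^sub>d\<close>, so that round spheres have positive Ricci curvature.\<close>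
definition riemann_up :: "metric \<Rightarrow> 4 \<Rightarrow> 4 \<Rightarrow> 4 \<Rightarrow> 4 \<Rightarrow> real^4 \<Rightarrow> real" where
  "riemann_up G a b c d x =
     pdiff c (christoffel G a d b) x - pdiff d (christoffel G a c b) x
     + (\<Sum>e\<in>UNIV. christoffel G a c e x * christoffel G e d b x
                 - christoffel G a d e x * christoffel G e c b x)"

definition riemann :: "metric \<Rightarrow> 4 \<Rightarrow> 4 \<Rightarrow> 4 \<Rightarrow> 4 \<Rightarrow> real^4 \<Rightarrow> real" where
  "riemann G a b c d x = (\<Sum>e\<in>UNIV. G x $ a $ e * riemann_up G e b c d x)"

definition ricci :: "metric \<Rightarrow> 4 \<Rightarrow> 4 \<Rightarrow> real^4 \<Rightarrow> real" where
  "ricci G b d x = (\<Sum>a\<in>UNIV. riemann_up G a b a d x)"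

definition scalar_curv :: "metric \<Rightarrow> real^4 \<Rightarrow> real" where
  "scalar_curv G x = (\<Sum>a\<in>UNIV. \<Sum>b\<in>UNIV. inv_metric G a b x * ricci G a b x)"

definition weyl :: "metric \<Rightarrow> 4 \<Rightarrow> 4 \<Rightarrow> 4 \<Rightarrow> 4 \<Rightarrow> real^4 \<Rightarrow> real" where
  "weyl G a b c d x = riemann G a b c d x
     - 1/2 * (G x $ a $ c * ricci G b d x - G x $ a $ d * ricci G b c x
              + G x $ b $ d * ricci G a c x - G x $ b $ c * ricci G a d x)
     + 1/6 * scalar_curv G x * (G x $ a $ c * G x $ b $ d - G x $ a $ d * G x $ b $ c)"

definition bach :: "metric \<Rightarrow> 4 \<Rightarrow> 4 \<Rightarrow> real^4 \<Rightarrow> real" where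
  "bach G a b x = (\<Sum>c\<in>UNIV. \<Sum>d\<in>UNIV. \<Sum>e\<in>UNIV. \<Sum>f\<in>UNIV.
     inv_metric G c e x * inv_metric G d f x *
     (cov_deriv G (cov_deriv G (ctensor4 (weyl G))) [e, f, a, c, b, d] x
      + 1/2 * ricci G e f x * weyl G a c b d x))"

definition hessian :: "metric \<Rightarrow> (real^4 \<Rightarrow> real) \<Rightarrow> 4 \<Rightarrow> 4 \<Rightarrow> real^4 \<Rightarrow> real" where
  "hessian G f a b x = cov_deriv G (cov_deriv G (ctensor0 f)) [a, b] x"

definition dalembertian :: "metric \<Rightarrow> (real^4 \<Rightarrow> real) \<Rightarrow> real^4 \<Rightarrow> real" where
  "dalembertian G f x = (\<Sum>a\<in>UNIV. \<Sum>b\<in>UNIV. inv_metric G a b x * hessian G f a b x)"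

definition quadratic_gravity_vacuum :: "real \<Rightarrow> real \<Rightarrow> real \<Rightarrow> real \<Rightarrow> 'p chart set
    \<Rightarrow> ('p chart \<Rightarrow> real^4 \<Rightarrow> real^4^4) \<Rightarrow> bool" where
  "quadratic_gravity_vacuum \<alpha> \<beta> \<gamma> \<Lambda> A g \<longleftrightarrow>
     (\<forall>c\<in>A. \<forall>x\<in>chart_image c. \<forall>a b.
        \<gamma> * (ricci (g c) a b x - 1/2 * scalar_curv (g c) x * g c x $ a $ b + \<Lambda> * g c x $ a $ b)
        - 4 * \<alpha> * bach (g c) a b x
        + 2 * \<beta> * (ricci (g c) a b x * scalar_curv (g c) x
                   - 1/4 * scalar_curv (g c) x * g c x $ a $ b * scalar_curv (g c) x
                   + g c x $ a $ b * dalembertian (g c) (scalar_curv (g c)) x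
                   - hessian (g c) (scalar_curv (g c)) b a x) = 0)"


definition sprod :: "real^4^4 \<Rightarrow> real^4 \<Rightarrow> real^4 \<Rightarrow> real" where
  "sprod G u v = (\<Sum>a\<in>UNIV. \<Sum>b\<in>UNIV. G $ a $ b * u $ a * v $ b)"

text \<open>\<open>e 0\<close>, \<open>e 1\<close>, \<open>e 2\<close>, \<open>e 3\<close> are \<open>\<ell>\<close>, \<open>n\<close>, \<open>m\<^sup>(\<^sup>2\<^sup>)\<close>, \<open>m\<^sup>(\<^sup>3\<^sup>)\<close>.\<close>
definition null_frame :: "real^4^4 \<Rightarrow> (4 \<Rightarrow> real^4) \<Rightarrow> bool" where
  "null_frame G e \<longleftrightarrow>
     sprod G (e 0) (e 0) = 0 \<and> sprod G (e 1) (e 1) = 0 \<and> sprod G (e 0) (e 1) = 1 \<and>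
     (\<forall>i\<in>{2,3}. \<forall>j\<in>{2,3}. sprod G (e i) (e j) = (if i = j then 1 else 0)) \<and>
     (\<forall>i\<in>{2,3}. sprod G (e 0) (e i) = 0 \<and> sprod G (e 1) (e i) = 0)"

definition boost :: "real \<Rightarrow> (4 \<Rightarrow> real^4) \<Rightarrow> 4 \<Rightarrow> real^4" where
  "boost \<mu> e i = (if i = 0 then \<mu> *\<^sub>R e 0 else if i = 1 then inverse \<mu> *\<^sub>R e 1 else e i)"

definition frame_comp :: "ctensor \<Rightarrow> real^4 \<Rightarrow> (4 \<Rightarrow> real^4) \<Rightarrow> 4 list \<Rightarrow> real" where
  "frame_comp T x e is =
     (\<Sum>js | length js = length is. (\<Prod>k<length is. e (is ! k) $ (js ! k)) * T js x)"

definition has_boost_weight ::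
    "ctensor \<Rightarrow> real^4 \<Rightarrow> (4 \<Rightarrow> real^4) \<Rightarrow> 4 list \<Rightarrow> int \<Rightarrow> bool" where
  "has_boost_weight T x e is w \<longleftrightarrow>
     (\<forall>\<mu>. \<mu> \<noteq> 0 \<longrightarrow> frame_comp T x (boost \<mu> e) is = \<mu> powi w * frame_comp T x e is)"

text \<open>The boost order of the zero tensor is \<open>-\<infinity>\<close>.\<close>
definition boost_order :: "nat \<Rightarrow> ctensor \<Rightarrow> real^4 \<Rightarrow> (4 \<Rightarrow> real^4) \<Rightarrow> ereal" where
  "boost_order r T x e = Sup {ereal (of_int w) | w is.
     length is = r \<and> frame_comp T x e is \<noteq> 0 \<and> has_boost_weight T x e is w}"

definition null_vector_field :: "'p chart set \<Rightarrow> ('p chart \<Rightarrow> real^4 \<Rightarrow> real^4^4)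
    \<Rightarrow> ('p chart \<Rightarrow> real^4 \<Rightarrow> real^4) \<Rightarrow> bool" where
  "null_vector_field A g l \<longleftrightarrow> smooth_vector_field A l \<and>
     (\<forall>c\<in>A. \<forall>x\<in>chart_image c. l c x \<noteq> 0 \<and> sprod (g c x) (l c x) (l c x) = 0)"

text \<open>The boost order depends on the frame only through its first vector \<open>\<ell>\<close>, and every nonzero
  null \<open>\<ell>\<close> can be completed to a null frame.\<close>
definition weyl_aligned :: "'p chart set \<Rightarrow> ('p chart \<Rightarrow> real^4 \<Rightarrow> real^4^4)
    \<Rightarrow> ('p chart \<Rightarrow> real^4 \<Rightarrow> real^4) \<Rightarrow> bool" where
  "weyl_aligned A g l \<longleftrightarrow>
     (\<forall>c\<in>A. \<forall>x\<in>chart_image c. \<forall>e. null_frame (g c x) e \<and> e 0 = l c x \<longrightarrow>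
        boost_order 4 (ctensor4 (weyl (g c))) x e \<le> 1)"

definition lower :: "metric \<Rightarrow> (real^4 \<Rightarrow> real^4) \<Rightarrow> 4 \<Rightarrow> real^4 \<Rightarrow> real" where
  "lower G l a x = (\<Sum>b\<in>UNIV. G x $ a $ b * l x $ b)"

text \<open>\<open>cov_deriv_lower G l a b\<close> is \<open>\<ell>\<^sub>a\<^sub>;\<^sub>b = \<nabla>\<^sub>b \<ell>\<^sub>a\<close>.\<close>
definition cov_deriv_lower :: "metric \<Rightarrow> (real^4 \<Rightarrow> real^4) \<Rightarrow> 4 \<Rightarrow> 4 \<Rightarrow> real^4 \<Rightarrow> real" where
  "cov_deriv_lower G l a b x = cov_deriv G (ctensor1 (lower G l)) [b, a] x"

text \<open>Affine parametrization is not required.\<close>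
definition geodetic :: "'p chart set \<Rightarrow> ('p chart \<Rightarrow> real^4 \<Rightarrow> real^4^4)
    \<Rightarrow> ('p chart \<Rightarrow> real^4 \<Rightarrow> real^4) \<Rightarrow> bool" where
  "geodetic A g l \<longleftrightarrow> (\<forall>c\<in>A. \<forall>x\<in>chart_image c. \<exists>\<kappa>. \<forall>a.
     (\<Sum>b\<in>UNIV. l c x $ b * cov_deriv_lower (g c) (l c) a b x) = \<kappa> * lower (g c) (l c) a x)"

definition optical_matrix :: "metric \<Rightarrow> (real^4 \<Rightarrow> real^4) \<Rightarrow> (4 \<Rightarrow> real^4) \<Rightarrow> 4 \<Rightarrow> 4
    \<Rightarrow> real^4 \<Rightarrow> real" where
  "optical_matrix G l e i j x =
     (\<Sum>a\<in>UNIV. \<Sum>b\<in>UNIV. cov_deriv_lower G l a b x * e i $ a * e j $ b)"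

text \<open>Vanishing of the optical matrix does not depend on the frame completing \<open>\<ell>\<close>, for
  geodetic \<open>\<ell>\<close>.\<close>
definition kundt :: "'p chart set \<Rightarrow> ('p chart \<Rightarrow> real^4 \<Rightarrow> real^4^4) \<Rightarrow> bool" where
  "kundt A g \<longleftrightarrow> (\<exists>l. null_vector_field A g l \<and> geodetic A g l \<and>
     (\<forall>c\<in>A. \<forall>x\<in>chart_image c. \<forall>e. null_frame (g c x) e \<and> e 0 = l c x \<longrightarrow>
        (\<forall>i\<in>{2,3}. \<forall>j\<in>{2,3}. optical_matrix (g c) (l c) e i j x = 0)))"

end

theory Submission
  imports Defs
begin

text \<open>The Ricci tensor is \<open>\<Lambda> g\<close> plus \<open>S = \<omega> \<ell> \<otimes> \<ell>\<close>, so the scalar curvature is constant and the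
  contracted Bianchi identity makes \<open>S\<close> divergence free; this forces \<open>\<ell>\<close> to be geodetic. The field
  equations reduce to \<open>4 \<alpha> B = (\<gamma> + 8 \<beta> \<Lambda>) S\<close>, so \<open>\<alpha> \<noteq> 0\<close> and \<open>B(m, m) = 0\<close> whenever
  \<open>m\<close> is orthogonal to \<open>\<ell>\<close>. By the Bianchi identity the divergence of the Weyl tensor is
  \<open>\<nabla>\<^sup>d C\<^sub>a\<^sub>c\<^sub>b\<^sub>d = 1/2 (\<nabla>\<^sub>c S\<^sub>a\<^sub>b - \<nabla>\<^sub>a S\<^sub>c\<^sub>b)\<close>. In \<open>B(m, m)\<close> the term \<open>\<nabla>\<^sup>c \<nabla>\<^sub>a S\<^sub>c\<^sub>b\<close>
  becomes a commutator of covariant derivatives, and it and the term \<open>R\<^sup>c\<^sup>d C\<^sub>a\<^sub>c\<^sub>b\<^sub>d\<close> only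
  contribute the Weyl component \<open>C(\<ell>, m, \<ell>, m)\<close> of boost weight 2, which vanishes by alignment. What
  remains is \<open>\<omega> v\<^sub>c v\<^sup>c\<close> with \<open>v\<^sub>c = m\<^sup>a \<nabla>\<^sub>c \<ell>\<^sub>a\<close>. For \<open>m = m\<^sup>(\<^sup>i\<^sup>)\<close> the covector \<open>v\<close> annihilates
  \<open>\<ell>\<close> because \<open>\<ell>\<close> is geodetic, hence \<open>v\<^sub>c v\<^sup>c\<close> is the sum of the squares of the entries in
  row \<open>i\<close> of the optical matrix.\<close>

section \<open>Partial derivatives and smooth functions\<close>

lemma pdiff_eq: "(f has_derivative f') (at x) \<Longrightarrow> pdiff a f x = f' (axis a 1)"
  by (metis frechet_derivative_at pdiff_def)

lemma has_derivative_pdiff: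
  "f differentiable (at x) \<Longrightarrow> (f has_derivative frechet_derivative f (at x)) (at x)"
  by (simp add: frechet_derivative_works)

lemma pdiff_const [simp]: "pdiff a (\<lambda>y. k) x = 0"
  by (simp add: pdiff_def)

lemma pdiff_add:
  assumes "f differentiable (at x)" "g differentiable (at x)"
  shows "pdiff a (\<lambda>y. f y + g y) x = pdiff a f x + pdiff a g x"
  by (subst pdiff_eq, rule has_derivative_add[OF assms[THEN has_derivative_pdiff]])
    (simp add: pdiff_def)

lemma pdiff_diff:
  assumes "f differentiable (at x)" "g differentiable (at x)"
  shows "pdiff a (\<lambda>y. f y - g y) x = pdiff a f x - pdiff a g x"
  by (subst pdiff_eq, rule has_derivative_diff[OF assms[THEN has_derivative_pdiff]])
    (simp add: pdiff_def)

lemma pdiff_minus: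
  assumes "f differentiable (at x)"
  shows "pdiff a (\<lambda>y. - f y) x = - pdiff a f x"
  by (subst pdiff_eq, rule has_derivative_minus[OF assms[THEN has_derivative_pdiff]])
    (simp add: pdiff_def)

lemma pdiff_mult:
  assumes "f differentiable (at x)" "g differentiable (at x)"
  shows "pdiff a (\<lambda>y. f y * g y) x = pdiff a f x * g x + f x * pdiff a g x"
  by (subst pdiff_eq, rule has_derivative_mult[OF assms[THEN has_derivative_pdiff]])
    (simp add: pdiff_def)

lemma pdiff_cmult:
  assumes "f differentiable (at x)"
  shows "pdiff a (\<lambda>y. k * f y) x = k * pdiff a f x"
  using pdiff_mult[of "\<lambda>y. k" x f a] assms by simp

lemma pdiff_sum:
  assumes "finite I" "\<And>i. i \<in> I \<Longrightarrow> f i differentiable (at x)"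
  shows "pdiff a (\<lambda>y. \<Sum>i\<in>I. f i y) x = (\<Sum>i\<in>I. pdiff a (f i) x)"
  by (subst pdiff_eq, rule has_derivative_sum, rule has_derivative_pdiff, rule assms(2))
    (simp_all add: pdiff_def)

text \<open>Metrics and tensor components are constrained only on a chart image, so an identity
  between them can be differentiated only through agreement on an open set.\<close>

lemma pdiff_cong:
  assumes "open U" "x \<in> U" "\<And>y. y \<in> U \<Longrightarrow> f y = g y"
  shows "pdiff a f x = pdiff a g x"
proof -
  have "(f has_derivative f') (at x) = (g has_derivative f') (at x)" for f'
    using has_derivative_transform_within_open[of f f' x UNIV U g]
      has_derivative_transform_within_open[of g f' x UNIV U f] assms by auto
  then show ?thesis by (simp add: pdiff_def frechet_derivative_def)
qed

lemma pdiff_inverse: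
  assumes "f differentiable (at x)" "f x \<noteq> 0"
  shows "pdiff a (\<lambda>y. inverse (f y)) x = - (inverse (f x) * pdiff a f x * inverse (f x))"
  by (subst pdiff_eq, rule Deriv.has_derivative_inverse[OF assms(2) has_derivative_pdiff[OF assms(1)]])
    (simp add: pdiff_def)

section \<open>Closure properties of finitely differentiable and of smooth functions\<close>

lemma Ck_on_cong:
  assumes "open S" "\<And>y. y \<in> S \<Longrightarrow> f y = g y"
  shows "Ck_on k S f \<longleftrightarrow> Ck_on k S g"
  using assms(2)
proof (induction k arbitrary: f g)
  case 0 then show ?case by (auto intro: continuous_on_cong)
next
  case (Suc k)
  have "f differentiable (at x) \<longleftrightarrow> g differentiable (at x)" if "x \<in> S" for x
    using has_derivative_transform_within_open[of f _ x UNIV S g]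
      has_derivative_transform_within_open[of g _ x UNIV S f] that Suc.prems assms(1)
    unfolding differentiable_def by auto
  moreover have "Ck_on k S (pdiff a f) \<longleftrightarrow> Ck_on k S (pdiff a g)" for a
    by (rule Suc.IH) (rule pdiff_cong[OF assms(1) _ Suc.prems])
  ultimately show ?case by simp
qed

text \<open>The product and inverse rules leave some factors undifferentiated; the inductions on the
  order below need these factors one order lower.\<close>

lemma Ck_on_SucD: "Ck_on (Suc k) S f \<Longrightarrow> Ck_on k S f"
proof (induction k arbitrary: f)
  case 0 then show ?case
    by (simp add: differentiable_imp_continuous_within continuous_at_imp_continuous_on)
next
  case (Suc k)
  then have "\<forall>a. Ck_on (Suc k) S (pdiff a f)" and "\<forall>x\<in>S. f differentiable (at x)"
    by (simp_all del: Ck_on.simps add: Ck_on.simps(2)[of "Suc k"])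
  with Suc.IH show ?case by (simp only: Ck_on.simps) blast
qed

lemma Ck_on_const: "Ck_on k S (\<lambda>y. c)"
proof (induction k arbitrary: c)
  case (Suc k)
  have "pdiff a (\<lambda>y. c) = (\<lambda>y. 0)" for a by (simp add: fun_eq_iff)
  with Suc show ?case by simp
qed simp

lemma Ck_on_add:
  assumes "open S"
  shows "Ck_on k S f \<Longrightarrow> Ck_on k S g \<Longrightarrow> Ck_on k S (\<lambda>y. f y + g y)"
proof (induction k arbitrary: f g)
  case 0 then show ?case by (simp add: continuous_on_add)
next
  case (Suc k)
  have "Ck_on k S (pdiff a (\<lambda>y. f y + g y)) \<longleftrightarrow> Ck_on k S (\<lambda>y. pdiff a f y + pdiff a g y)" for a
    by (rule Ck_on_cong[OF assms], rule pdiff_add) (use Suc.prems in auto)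
  then show ?case using Suc by simp
qed

lemma Ck_on_mult:
  assumes "open S"
  shows "Ck_on k S f \<Longrightarrow> Ck_on k S g \<Longrightarrow> Ck_on k S (\<lambda>y. f y * g y)"
proof (induction k arbitrary: f g)
  case 0 then show ?case by (simp add: continuous_on_mult)
next
  case (Suc k)
  have "Ck_on k S (pdiff a (\<lambda>y. f y * g y))
      \<longleftrightarrow> Ck_on k S (\<lambda>y. pdiff a f y * g y + f y * pdiff a g y)" for a
    by (rule Ck_on_cong[OF assms], rule pdiff_mult) (use Suc.prems in auto)
  moreover have "Ck_on k S (\<lambda>y. pdiff a f y * g y + f y * pdiff a g y)" for a
    using Suc.IH Suc.prems Ck_on_SucD[OF Suc.prems(1)] Ck_on_SucD[OF Suc.prems(2)]
    by (auto intro!: Ck_on_add[OF assms])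
  ultimately show ?case using Suc.prems by simp
qed

text \<open>The derivative contains \<open>inverse f\<close> only undifferentiated, so the induction
  hypothesis and closure under products suffice.\<close>

lemma Ck_on_inverse:
  assumes "open S" and nz: "\<And>x. x \<in> S \<Longrightarrow> f x \<noteq> 0"
  shows "Ck_on k S f \<Longrightarrow> Ck_on k S (\<lambda>y. inverse (f y))"
proof (induction k)
  case 0 then show ?case using nz by (auto intro: continuous_on_inverse)
next
  case (Suc k)
  have "Ck_on k S (pdiff a (\<lambda>y. inverse (f y)))
      \<longleftrightarrow> Ck_on k S (\<lambda>y. (-1) * (inverse (f y) * pdiff a f y * inverse (f y)))" for a
    by (rule Ck_on_cong[OF assms(1)]) (use Suc.prems nz in \<open>auto simp: pdiff_inverse\<close>)
  moreover have "Ck_on k S (\<lambda>y. (-1) * (inverse (f y) * pdiff a f y * inverse (f y)))" for a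
    using Suc.IH[OF Ck_on_SucD[OF Suc.prems]] Suc.prems
    by (intro Ck_on_mult[OF assms(1)] Ck_on_const) auto
  ultimately show ?case using Suc.prems nz by (simp add: differentiable_inverse)
qed

named_theorems smooth_intros

lemma smooth_on_differentiable: "smooth_on S f \<Longrightarrow> x \<in> S \<Longrightarrow> f differentiable (at x)"
  unfolding smooth_on_def by (metis Ck_on.simps(2))

lemma smooth_on_cong:
  "open S \<Longrightarrow> (\<And>y. y \<in> S \<Longrightarrow> f y = g y) \<Longrightarrow> smooth_on S f \<longleftrightarrow> smooth_on S g"
  unfolding smooth_on_def using Ck_on_cong by blast

lemma smooth_on_pdiff [smooth_intros]: "smooth_on S f \<Longrightarrow> smooth_on S (pdiff a f)"
  unfolding smooth_on_def by (metis Ck_on.simps(2))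

lemma smooth_on_const [smooth_intros]: "smooth_on S (\<lambda>y. c)"
  by (simp add: smooth_on_def Ck_on_const)

lemma smooth_on_add [smooth_intros]:
  "open S \<Longrightarrow> smooth_on S f \<Longrightarrow> smooth_on S g \<Longrightarrow> smooth_on S (\<lambda>y. f y + g y)"
  by (simp add: smooth_on_def Ck_on_add)

lemma smooth_on_mult [smooth_intros]:
  "open S \<Longrightarrow> smooth_on S f \<Longrightarrow> smooth_on S g \<Longrightarrow> smooth_on S (\<lambda>y. f y * g y)"
  by (simp add: smooth_on_def Ck_on_mult)

lemma smooth_on_minus [smooth_intros]:
  "open S \<Longrightarrow> smooth_on S f \<Longrightarrow> smooth_on S (\<lambda>y. - f y)"
  using smooth_on_mult[of S "\<lambda>y. -1" f] by (simp add: smooth_on_const)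

lemma smooth_on_diff [smooth_intros]:
  "open S \<Longrightarrow> smooth_on S f \<Longrightarrow> smooth_on S g \<Longrightarrow> smooth_on S (\<lambda>y. f y - g y)"
  using smooth_on_add[of S f "\<lambda>y. - g y"] by (simp add: smooth_on_minus)

lemma smooth_on_sum [smooth_intros]:
  "open S \<Longrightarrow> (\<And>i. i \<in> I \<Longrightarrow> smooth_on S (f i)) \<Longrightarrow> smooth_on S (\<lambda>y. \<Sum>i\<in>I. f i y)"
  by (induction I rule: infinite_finite_induct) (simp_all add: smooth_on_const smooth_on_add)

lemma smooth_on_prod [smooth_intros]:
  "open S \<Longrightarrow> (\<And>i. i \<in> I \<Longrightarrow> smooth_on S (f i)) \<Longrightarrow> smooth_on S (\<lambda>y. \<Prod>i\<in>I. f i y)"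
  by (induction I rule: infinite_finite_induct) (simp_all add: smooth_on_const smooth_on_mult)

lemma smooth_on_divide:
  "open S \<Longrightarrow> (\<And>x. x \<in> S \<Longrightarrow> g x \<noteq> 0) \<Longrightarrow> smooth_on S f \<Longrightarrow> smooth_on S g
    \<Longrightarrow> smooth_on S (\<lambda>y. f y / g y)"
  unfolding divide_inverse
  by (rule smooth_on_mult) (auto simp: smooth_on_def Ck_on_inverse)

lemma smooth_on_det [smooth_intros]:
  fixes M :: "real^4 \<Rightarrow> real^'n^'n"
  assumes "open S" "\<And>i j. smooth_on S (\<lambda>y. M y $ i $ j)"
  shows "smooth_on S (\<lambda>y. det (M y))"
  unfolding det_def by (intro smooth_intros assms)

text \<open>Cramer's rule writes the entries of the inverse as quotients of determinants, which are
  polynomial in the entries of \<open>M\<close>; this makes the inverse metric smooth.\<close>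

lemma matrix_inv_cramer:
  fixes M :: "real^'n^'n"
  assumes "invertible M"
  shows "matrix_inv M $ a $ b = det (\<chi> i j. if j = a then mat 1 $ i $ b else M $ i $ j) / det M"
proof -
  have "M ** matrix_inv M = mat 1"
    using assms unfolding invertible_def matrix_inv_def by (rule someI2_ex) simp
  \<comment> \<open>Column \<open>b\<close> of the inverse solves the linear system whose right-hand
    side is the unit vector with index \<open>b\<close>.\<close>
  then have "M *v column b (matrix_inv M) = column b (mat 1)"
    by (auto simp: vec_eq_iff column_def matrix_vector_mult_def matrix_matrix_mult_def)
  then have "column b (matrix_inv M) =
      (\<chi> k. det (\<chi> i j. if j = k then column b (mat 1) $ i else M $ i $ j) / det M)"
    using cramer assms invertible_det_nz by blast
  then have "column b (matrix_inv M) $ a =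
      det (\<chi> i j. if j = a then column b (mat 1) $ i else M $ i $ j) / det M"
    by simp
  then show ?thesis unfolding column_def vec_lambda_beta .
qed

lemma smooth_on_inv_metric:
  assumes "open S" "\<And>x. x \<in> S \<Longrightarrow> invertible (M x)" "\<And>i j. smooth_on S (\<lambda>y. M y $ i $ j)"
  shows "smooth_on S (inv_metric M a b)"
proof -
  have "smooth_on S (\<lambda>x. det (\<chi> i j. if j = a then mat 1 $ i $ b else M x $ i $ j) / det (M x))"
  proof (intro smooth_on_divide smooth_on_det assms(1))
    show "smooth_on S (\<lambda>x. (\<chi> i j. if j = a then mat 1 $ i $ b else M x $ i $ j) $ i $ j)" for i j
      by (cases "j = a") (simp_all add: smooth_on_const assms)
  qed (use assms invertible_det_nz in blast)+
  then show ?thesis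
    by (subst smooth_on_cong[OF assms(1)]) (auto simp: inv_metric_def matrix_inv_cramer assms(2))
qed

section \<open>Symmetry of second partial derivatives\<close>

lemma has_real_derivative_line:
  assumes "f differentiable (at (p + t *\<^sub>R axis a 1))"
  shows "((\<lambda>s. f (p + s *\<^sub>R axis a 1)) has_real_derivative pdiff a f (p + t *\<^sub>R axis a 1)) (at t)"
proof -
  have "((\<lambda>s. p + s *\<^sub>R axis a 1) has_derivative (\<lambda>s. s *\<^sub>R axis a 1)) (at t)"
    by (auto intro!: derivative_eq_intros)
  from has_derivative_compose[OF this has_derivative_pdiff[OF assms]]
  have *: "((\<lambda>s. f (p + s *\<^sub>R axis a 1)) has_derivative
     (\<lambda>s. frechet_derivative f (at (p + t *\<^sub>R axis a 1)) (s *\<^sub>R axis a 1))) (at t)" .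
  have "frechet_derivative f (at (p + t *\<^sub>R axis a 1)) (s *\<^sub>R axis a 1)
      = pdiff a f (p + t *\<^sub>R axis a 1) * s" for s
    unfolding pdiff_def using linear_frechet_derivative[OF assms]
    by (simp add: linear_cmul)
  with * show ?thesis by (simp add: has_field_derivative_def)
qed

text \<open>Two applications of the one-variable mean value theorem, first in direction
  \<open>a\<close>, then in direction \<open>b\<close>.\<close>

lemma mixed_difference:
  assumes "smooth_on S f" "0 < h"
    and S: "\<And>s t. 0 \<le> s \<Longrightarrow> s \<le> h \<Longrightarrow> 0 \<le> t \<Longrightarrow> t \<le> h \<Longrightarrow> x + s *\<^sub>R axis a 1 + t *\<^sub>R axis b 1 \<in> S"
  obtains s t where "0 \<le> s" "s \<le> h" "0 \<le> t" "t \<le> h"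
    "f (x + h *\<^sub>R axis a 1 + h *\<^sub>R axis b 1) - f (x + h *\<^sub>R axis a 1) - f (x + h *\<^sub>R axis b 1) + f x
      = h * (h * pdiff b (pdiff a f) (x + s *\<^sub>R axis a 1 + t *\<^sub>R axis b 1))"
proof -
  let ?a = "axis a 1 :: real^4" and ?b = "axis b 1 :: real^4"
  \<comment> \<open>The difference in direction \<open>b\<close> as a function of the position along
    \<open>a\<close>; its increment from 0 to \<open>h\<close> is the second difference.\<close>
  define \<phi> where "\<phi> s = f (x + h *\<^sub>R ?b + s *\<^sub>R ?a) - f (x + s *\<^sub>R ?a)" for s
  have S': "x + h *\<^sub>R ?b + s *\<^sub>R ?a \<in> S" "x + s *\<^sub>R ?a \<in> S" if "0 \<le> s" "s \<le> h" for s
    using S[of s h] S[of s 0] that assms(2) by (simp_all add: ac_simps)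
  have "(\<phi> has_real_derivative
      (pdiff a f (x + h *\<^sub>R ?b + s *\<^sub>R ?a) - pdiff a f (x + s *\<^sub>R ?a))) (at s)" if "0 \<le> s" "s \<le> h" for s
    unfolding \<phi>_def using that S'
    by (intro DERIV_diff has_real_derivative_line smooth_on_differentiable[OF assms(1)])
  from MVT2[OF assms(2) this] obtain s where s: "0 < s" "s < h"
    "\<phi> h - \<phi> 0 = (h - 0) * (pdiff a f (x + h *\<^sub>R ?b + s *\<^sub>R ?a) - pdiff a f (x + s *\<^sub>R ?a))" by blast
  have "((\<lambda>t. pdiff a f (x + s *\<^sub>R ?a + t *\<^sub>R ?b)) has_real_derivative
      pdiff b (pdiff a f) (x + s *\<^sub>R ?a + t *\<^sub>R ?b)) (at t)" if "0 \<le> t" "t \<le> h" for t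
    using that s S
    by (intro has_real_derivative_line smooth_on_differentiable[OF smooth_on_pdiff[OF assms(1)]]) auto
  from MVT2[OF assms(2) this] obtain t where t: "0 < t" "t < h"
    "pdiff a f (x + s *\<^sub>R ?a + h *\<^sub>R ?b) - pdiff a f (x + s *\<^sub>R ?a + 0 *\<^sub>R ?b)
      = (h - 0) * pdiff b (pdiff a f) (x + s *\<^sub>R ?a + t *\<^sub>R ?b)" by blast
  have "\<phi> h - \<phi> 0 = h * (h * pdiff b (pdiff a f) (x + s *\<^sub>R ?a + t *\<^sub>R ?b))"
    using s(3) t(3) by (simp add: ac_simps)
  then show thesis
    using that[of s t] s t unfolding \<phi>_def by (simp add: algebra_simps)
qed

text \<open>The second difference is symmetric in the two directions. So for every small
  \<open>h\<close> both mixed derivatives take a common value at points near \<open>x\<close>, and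
  by continuity they cannot differ at \<open>x\<close>.\<close>

lemma pdiff_commute:
  assumes "open S" "smooth_on S f" "x \<in> S"
  shows "pdiff a (pdiff b f) x = pdiff b (pdiff a f) x"
proof (rule ccontr)
  let ?p = "pdiff b (pdiff a f)" and ?q = "pdiff a (pdiff b f)"
  assume "?q x \<noteq> ?p x"
  then have e: "0 < \<bar>?q x - ?p x\<bar> / 2" (is "0 < ?e") by simp
  have "continuous (at x) ?p" "continuous (at x) ?q"
    using smooth_on_differentiable[OF _ assms(3)] smooth_on_pdiff assms(2)
      differentiable_imp_continuous_within by blast+
  with e obtain d1 d2 where d: "0 < d1" "0 < d2"
    "\<And>y. dist y x < d1 \<Longrightarrow> dist (?p y) (?p x) < ?e" "\<And>y. dist y x < d2 \<Longrightarrow> dist (?q y) (?q x) < ?e"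
    unfolding continuous_at_eps_delta by metis
  obtain d3 where d3: "0 < d3" "ball x d3 \<subseteq> S" using assms(1,3) open_contains_ball by blast
  \<comment> \<open>The points supplied by \<open>mixed_difference\<close> lie within
    \<open>2 * h\<close> of \<open>x\<close>, and two thirds of a positive bound is strictly below
    it.\<close>
  define h where "h = min (min d1 d2) d3 / 3"
  have h: "0 < h" using d d3 by (simp add: h_def)
  have near: "dist (x + s *\<^sub>R axis i 1 + t *\<^sub>R axis j 1) x < min (min d1 d2) d3"
    if "0 \<le> s" "s \<le> h" "0 \<le> t" "t \<le> h" for s t and i j :: 4
  proof -
    have "dist (x + s *\<^sub>R axis i 1 + t *\<^sub>R axis j 1) x \<le> norm (s *\<^sub>R axis i 1 :: real^4)
        + norm (t *\<^sub>R axis j 1 :: real^4)"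
      unfolding dist_norm using norm_triangle_ineq[of "s *\<^sub>R axis i 1 :: real^4" "t *\<^sub>R axis j 1"]
      by (simp add: algebra_simps)
    also have "\<dots> \<le> 2 * h" using that by simp
    also have "\<dots> < min (min d1 d2) d3" using d d3 by (simp add: h_def) linarith
    finally show ?thesis .
  qed
  then have inS: "x + s *\<^sub>R axis i 1 + t *\<^sub>R axis j 1 \<in> S"
    if "0 \<le> s" "s \<le> h" "0 \<le> t" "t \<le> h" for s t and i j :: 4
    using that d3 by (fastforce simp: dist_commute)
  obtain s t where 1: "0 \<le> s" "s \<le> h" "0 \<le> t" "t \<le> h"
    "f (x + h *\<^sub>R axis a 1 + h *\<^sub>R axis b 1) - f (x + h *\<^sub>R axis a 1) - f (x + h *\<^sub>R axis b 1) + f x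
      = h * (h * ?p (x + s *\<^sub>R axis a 1 + t *\<^sub>R axis b 1))"
    by (rule mixed_difference[OF assms(2) h, where x=x and a=a and b=b]) (use inS in auto)
  obtain s' t' where 2: "0 \<le> s'" "s' \<le> h" "0 \<le> t'" "t' \<le> h"
    "f (x + h *\<^sub>R axis b 1 + h *\<^sub>R axis a 1) - f (x + h *\<^sub>R axis b 1) - f (x + h *\<^sub>R axis a 1) + f x
      = h * (h * ?q (x + s' *\<^sub>R axis b 1 + t' *\<^sub>R axis a 1))"
    by (rule mixed_difference[OF assms(2) h, where x=x and a=b and b=a]) (use inS in auto)
  have "x + h *\<^sub>R axis b 1 + h *\<^sub>R axis a 1 = x + h *\<^sub>R axis a 1 + h *\<^sub>R axis b 1" by simp
  with 1(5) 2(5) have "h * (h * ?p (x + s *\<^sub>R axis a 1 + t *\<^sub>R axis b 1))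
      = h * (h * ?q (x + s' *\<^sub>R axis b 1 + t' *\<^sub>R axis a 1))"
    by (simp only:)
  with h have "?p (x + s *\<^sub>R axis a 1 + t *\<^sub>R axis b 1) = ?q (x + s' *\<^sub>R axis b 1 + t' *\<^sub>R axis a 1)"
    by simp
  moreover have "dist (?p (x + s *\<^sub>R axis a 1 + t *\<^sub>R axis b 1)) (?p x) < ?e"
    using near[of s t a b] 1 d(3) by simp
  moreover have "dist (?q (x + s' *\<^sub>R axis b 1 + t' *\<^sub>R axis a 1)) (?q x) < ?e"
    using near[of s' t' b a] 2 d(4) by simp
  \<comment> \<open>One number cannot be nearer than half the distance of \<open>u\<close> and
    \<open>v\<close> to both of them.\<close>
  moreover have False if "z = w" "dist z u < \<bar>v - u\<bar> / 2" "dist w v < \<bar>v - u\<bar> / 2" for z w u v :: real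
    using that by (auto simp: dist_real_def abs_if split: if_splits)
  ultimately show False by blast
qed

section \<open>The Levi-Civita connection and the curvature in a chart\<close>

lemma matrix_diff_ldistrib: "A ** (B - C) = A ** B - A ** (C :: 'a::ring_1^'m^'n)"
  by (simp add: vec_eq_iff matrix_matrix_mult_def right_diff_distrib sum_subtractf)

lemma matrix_diff_rdistrib: "(B - C) ** A = B ** A - C ** (A :: 'a::ring_1^'m^'n)"
  by (simp add: vec_eq_iff matrix_matrix_mult_def left_diff_distrib sum_subtractf)

lemma matrix_add_rdistrib: "(B + C) ** A = B ** A + C ** (A :: 'a::ring_1^'m^'n)"
  by (simp add: vec_eq_iff matrix_matrix_mult_def distrib_right sum.distrib)

lemma transpose_add: "transpose (A + B) = transpose A + transpose B"
  by (simp add: vec_eq_iff transpose_def)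

lemma transpose_diff: "transpose (A - B) = transpose A - transpose B"
  by (simp add: vec_eq_iff transpose_def)

lemmas matrix_distribs = matrix_add_ldistrib matrix_add_rdistrib matrix_diff_ldistrib
  matrix_diff_rdistrib

lemma matrix_inv_right: "invertible A \<Longrightarrow> A ** matrix_inv A = mat 1"
  and matrix_inv_left: "invertible A \<Longrightarrow> matrix_inv A ** A = mat 1"
  unfolding invertible_def matrix_inv_def by (metis (mono_tags, lifting) someI_ex)+

text \<open>Matrix notation turns the index sums of the curvature identities into noncommutative
  algebra, which the distributive and associative laws settle.\<close>

definition pdiff_mat :: "4 \<Rightarrow> (real^4 \<Rightarrow> real^4^4) \<Rightarrow> real^4 \<Rightarrow> real^4^4" where
  "pdiff_mat e M x = (\<chi> a b. pdiff e (\<lambda>y. M y $ a $ b) x)"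

definition smooth_mat :: "(real^4) set \<Rightarrow> (real^4 \<Rightarrow> real^4^4) \<Rightarrow> bool" where
  "smooth_mat U M \<longleftrightarrow> (\<forall>a b. smooth_on U (\<lambda>y. M y $ a $ b))"

lemma smooth_mat_pdiff: "smooth_mat U M \<Longrightarrow> smooth_mat U (pdiff_mat e M)"
  by (simp add: smooth_mat_def pdiff_mat_def smooth_on_pdiff)

lemma smooth_mat_mult: "open U \<Longrightarrow> smooth_mat U M \<Longrightarrow> smooth_mat U N \<Longrightarrow> smooth_mat U (\<lambda>y. M y ** N y)"
  by (simp add: smooth_mat_def matrix_matrix_mult_def smooth_on_sum smooth_on_mult)

lemma smooth_mat_add: "open U \<Longrightarrow> smooth_mat U M \<Longrightarrow> smooth_mat U N \<Longrightarrow> smooth_mat U (\<lambda>y. M y + N y)"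
  by (simp add: smooth_mat_def smooth_on_add)

lemma smooth_mat_diff: "open U \<Longrightarrow> smooth_mat U M \<Longrightarrow> smooth_mat U N \<Longrightarrow> smooth_mat U (\<lambda>y. M y - N y)"
  by (simp add: smooth_mat_def smooth_on_diff)

lemma smooth_mat_transpose: "smooth_mat U M \<Longrightarrow> smooth_mat U (\<lambda>y. transpose (M y))"
  by (simp add: smooth_mat_def transpose_def)

lemmas smooth_mat_intros =
  smooth_mat_pdiff smooth_mat_mult smooth_mat_add smooth_mat_diff smooth_mat_transpose

context
  fixes U x M N
  assumes M: "smooth_mat U M" and N: "smooth_mat U N" and x: "x \<in> U"
begin

lemma pdiff_mat_add: "pdiff_mat e (\<lambda>y. M y + N y) x = pdiff_mat e M x + pdiff_mat e N x"
  using M N x by (simp add: vec_eq_iff pdiff_mat_def smooth_mat_def pdiff_add smooth_on_differentiable[OF _ x])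

lemma pdiff_mat_diff: "pdiff_mat e (\<lambda>y. M y - N y) x = pdiff_mat e M x - pdiff_mat e N x"
  using M N x by (simp add: vec_eq_iff pdiff_mat_def smooth_mat_def pdiff_diff smooth_on_differentiable[OF _ x])

lemma pdiff_mat_mult:
  "pdiff_mat e (\<lambda>y. M y ** N y) x = pdiff_mat e M x ** N x + M x ** pdiff_mat e N x"
  using M N x by (simp add: vec_eq_iff pdiff_mat_def smooth_mat_def matrix_matrix_mult_def
      pdiff_sum pdiff_mult smooth_on_differentiable[OF _ x] sum.distrib)

end

lemma pdiff_mat_transpose: "pdiff_mat e (\<lambda>y. transpose (M y)) x = transpose (pdiff_mat e M x)"
  by (simp add: vec_eq_iff pdiff_mat_def transpose_def)

lemma pdiff_mat_commute:
  "open U \<Longrightarrow> smooth_mat U M \<Longrightarrow> x \<in> U \<Longrightarrow> pdiff_mat c (pdiff_mat d M) x = pdiff_mat d (pdiff_mat c M) x"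
  by (simp add: vec_eq_iff pdiff_mat_def smooth_mat_def pdiff_commute)

lemma pdiff_mat_cong:
  "open U \<Longrightarrow> x \<in> U \<Longrightarrow> (\<And>y. y \<in> U \<Longrightarrow> M y = N y) \<Longrightarrow> pdiff_mat e M x = pdiff_mat e N x"
  by (auto simp: vec_eq_iff pdiff_mat_def intro!: pdiff_cong)

section \<open>Christoffel symbols and compatibility with the metric\<close>

locale chart_metric =
  fixes U :: "(real^4) set" and G :: metric
  assumes open_U: "open U"
    and smooth_G: "smooth_on U (\<lambda>y. G y $ a $ b)"
    and G_sym: "x \<in> U \<Longrightarrow> G x $ a $ b = G x $ b $ a"
    and G_invertible: "x \<in> U \<Longrightarrow> invertible (G x)"
begin

abbreviation "h \<equiv> inv_metric G"
abbreviation "\<Gamma> \<equiv> christoffel G"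

lemma smooth_h: "smooth_on U (h a b)"
  by (rule smooth_on_inv_metric[OF open_U G_invertible smooth_G])

lemma smooth_\<Gamma>: "smooth_on U (\<Gamma> a b c)"
  unfolding christoffel_def by (intro smooth_intros open_U smooth_h smooth_G)

lemma smooth_riemann_up: "smooth_on U (riemann_up G a b c d)"
  unfolding riemann_up_def by (intro smooth_intros open_U smooth_\<Gamma>)

lemma smooth_riemann: "smooth_on U (riemann G a b c d)"
  unfolding riemann_def by (intro smooth_intros open_U smooth_riemann_up smooth_G)

lemma smooth_ricci: "smooth_on U (ricci G a b)"
  unfolding ricci_def by (intro smooth_intros open_U smooth_riemann_up)

lemma smooth_scalar_curv: "smooth_on U (scalar_curv G)"
  unfolding scalar_curv_def by (intro smooth_intros open_U smooth_ricci smooth_h)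

lemma smooth_weyl: "smooth_on U (weyl G a b c d)"
  unfolding weyl_def
  by (intro smooth_intros open_U smooth_riemann smooth_ricci smooth_scalar_curv smooth_G)

lemma smooth_cov_deriv:
  assumes "\<And>js. length js = length is \<Longrightarrow> smooth_on U (T js)"
  shows "smooth_on U (cov_deriv G T (e # is))"
  unfolding cov_deriv_def using assms
  by (simp, intro smooth_intros open_U smooth_\<Gamma>) auto

lemma cov_deriv_cong:
  assumes "x \<in> U" "\<And>js y. length js = length is \<Longrightarrow> y \<in> U \<Longrightarrow> T js y = T' js y"
  shows "cov_deriv G T (e # is) x = cov_deriv G T' (e # is) x"
  using assms by (simp add: cov_deriv_def pdiff_cong[OF open_U assms(1), of "T is" "T' is"])

lemma h_sym: "x \<in> U \<Longrightarrow> h a b x = h b a x"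
proof -
  assume x: "x \<in> U"
  have "transpose (G x) = G x" using G_sym[OF x] by (auto simp: vec_eq_iff transpose_def)
  then have "transpose (matrix_inv (G x)) ** G x = mat 1"
    using matrix_inv_right[OF G_invertible[OF x]] by (metis matrix_transpose_mul transpose_mat)
  then have "transpose (matrix_inv (G x)) = matrix_inv (G x)"
    using matrix_inv_right[OF G_invertible[OF x]]
      matrix_mul_assoc[of "transpose (matrix_inv (G x))" "G x" "matrix_inv (G x)"] by simp
  then show ?thesis by (simp add: inv_metric_def vec_eq_iff transpose_def)
qed

lemma G_h: "x \<in> U \<Longrightarrow> (\<Sum>b\<in>UNIV. G x $ a $ b * h b c x) = (if a = c then 1 else 0)"
  using matrix_inv_right[OF G_invertible, of x]
  by (simp add: vec_eq_iff matrix_matrix_mult_def mat_def inv_metric_def)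

lemma h_G: "x \<in> U \<Longrightarrow> (\<Sum>b\<in>UNIV. h a b x * G x $ b $ c) = (if a = c then 1 else 0)"
  using matrix_inv_left[OF G_invertible, of x]
  by (simp add: vec_eq_iff matrix_matrix_mult_def mat_def inv_metric_def)

lemma lower_raise: "x \<in> U \<Longrightarrow> (\<Sum>d\<in>UNIV. G x $ a $ d * (\<Sum>k\<in>UNIV. h d k x * F k)) = F a"
proof -
  assume x: "x \<in> U"
  have "(\<Sum>d\<in>UNIV. G x $ a $ d * (\<Sum>k\<in>UNIV. h d k x * F k))
      = (\<Sum>k\<in>UNIV. (\<Sum>d\<in>UNIV. G x $ a $ d * h d k x) * F k)"
    by (simp add: sum_distrib_left sum_distrib_right mult.assoc) (rule sum.swap)
  also have "\<dots> = (\<Sum>k\<in>UNIV. (if a = k then F k else 0))"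
    by (rule sum.cong) (simp_all add: G_h[OF x])
  finally show ?thesis by simp
qed

lemma raise_lower: "x \<in> U \<Longrightarrow> (\<Sum>d\<in>UNIV. h a d x * (\<Sum>k\<in>UNIV. G x $ d $ k * F k)) = F a"
proof -
  assume x: "x \<in> U"
  have "(\<Sum>d\<in>UNIV. h a d x * (\<Sum>k\<in>UNIV. G x $ d $ k * F k))
      = (\<Sum>k\<in>UNIV. (\<Sum>d\<in>UNIV. h a d x * G x $ d $ k) * F k)"
    by (simp add: sum_distrib_left sum_distrib_right mult.assoc) (rule sum.swap)
  also have "\<dots> = (\<Sum>k\<in>UNIV. (if a = k then F k else 0))"
    by (rule sum.cong) (simp_all add: h_G[OF x])
  finally show ?thesis by simp
qed

lemma pdiff_G_sym: "x \<in> U \<Longrightarrow> pdiff c (\<lambda>y. G y $ a $ b) x = pdiff c (\<lambda>y. G y $ b $ a) x"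
  by (rule pdiff_cong[OF open_U]) (auto intro: G_sym)

lemma \<Gamma>_sym: "x \<in> U \<Longrightarrow> \<Gamma> a b c x = \<Gamma> a c b x"
  unfolding christoffel_def using pdiff_G_sym[of x] by (simp add: add.commute)

text \<open>These are the Christoffel symbols of the first kind: lowering cancels the inverse metric
  in \<open>christoffel\<close>.\<close>

lemma lower_\<Gamma>: "x \<in> U \<Longrightarrow> (\<Sum>d\<in>UNIV. G x $ a $ d * \<Gamma> d b c x)
    = 1/2 * (pdiff b (\<lambda>y. G y $ a $ c) x + pdiff c (\<lambda>y. G y $ a $ b) x - pdiff a (\<lambda>y. G y $ b $ c) x)"
  using lower_raise[of x a "\<lambda>k. pdiff b (\<lambda>y. G y $ k $ c) x + pdiff c (\<lambda>y. G y $ k $ b) x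
      - pdiff k (\<lambda>y. G y $ b $ c) x"]
  unfolding christoffel_def
      by (simp add: mult.left_commute[of _ "1/2"] flip: sum_distrib_left sum_divide_distrib)

text \<open>For a fixed direction \<open>c\<close> the connection acts on vectors through
  \<open>\<Gamma>m c\<close>, the row being the upper index; \<open>Rm c d\<close> is the curvature
  endomorphism of the \<open>c\<close>-\<open>d\<close> plane.\<close>

definition \<Gamma>m :: "4 \<Rightarrow> real^4 \<Rightarrow> real^4^4" where "\<Gamma>m c x = (\<chi> a b. \<Gamma> a c b x)"
definition Hm :: "real^4 \<Rightarrow> real^4^4" where "Hm x = matrix_inv (G x)"
definition Rm :: "4 \<Rightarrow> 4 \<Rightarrow> real^4 \<Rightarrow> real^4^4" where "Rm c d x = (\<chi> a b. riemann_up G a b c d x)"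

lemma smooth_mats: "smooth_mat U G" "smooth_mat U (\<Gamma>m c)" "smooth_mat U Hm" "smooth_mat U (Rm c d)"
  using smooth_h by (simp_all add: smooth_mat_def \<Gamma>m_def Hm_def Rm_def smooth_G smooth_\<Gamma> inv_metric_def[abs_def]
      smooth_riemann_up)

text \<open>In the sum of the two symbols of the first kind only the derivative in direction
  \<open>c\<close> survives. In covariant terms, \<open>G\<close> is parallel.\<close>

lemma metric_compat: "x \<in> U \<Longrightarrow> pdiff c (\<lambda>y. G y $ a $ b) x
    = (\<Sum>d\<in>UNIV. \<Gamma> d c a x * G x $ d $ b) + (\<Sum>d\<in>UNIV. G x $ a $ d * \<Gamma> d c b x)"
proof -
  assume x: "x \<in> U"
  have "(\<Sum>d\<in>UNIV. \<Gamma> d c a x * G x $ d $ b) = (\<Sum>d\<in>UNIV. G x $ b $ d * \<Gamma> d c a x)"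
    by (simp add: G_sym[OF x, of b] mult.commute)
  then show ?thesis
    by (simp only: lower_\<Gamma>[OF x]) (simp add: pdiff_G_sym[OF x, of _ c] pdiff_G_sym[OF x, of _ b a] field_simps)
qed

lemma metric_compat_mat: "x \<in> U \<Longrightarrow> pdiff_mat c G x = transpose (\<Gamma>m c x) ** G x + G x ** \<Gamma>m c x"
  by (simp add: vec_eq_iff pdiff_mat_def transpose_def \<Gamma>m_def matrix_matrix_mult_def metric_compat)

text \<open>Differentiate \<open>G y ** Hm y = mat 1\<close> and multiply by \<open>Hm x\<close>
  from the left.\<close>

lemma inv_metric_compat_mat: "x \<in> U \<Longrightarrow> pdiff_mat c Hm x = - (Hm x ** transpose (\<Gamma>m c x)) - \<Gamma>m c x ** Hm x"
proof -
  assume x: "x \<in> U"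
  have HG: "Hm x ** G x = mat 1" and GH: "\<And>y. y \<in> U \<Longrightarrow> G y ** Hm y = mat 1"
    using G_invertible x by (simp_all add: Hm_def matrix_inv_left matrix_inv_right)
  have "pdiff_mat c (\<lambda>y. G y ** Hm y) x = pdiff_mat c (\<lambda>y. mat 1) x"
    by (rule pdiff_mat_cong[OF open_U x GH])
  also have "\<dots> = 0" by (simp add: pdiff_mat_def vec_eq_iff)
  finally have "pdiff_mat c G x ** Hm x + G x ** pdiff_mat c Hm x = 0"
    by (simp add: pdiff_mat_mult[OF smooth_mats(1,3) x])
  then have "Hm x ** (pdiff_mat c G x ** Hm x + G x ** pdiff_mat c Hm x) = 0"
    by (simp add: matrix_matrix_mult_def vec_eq_iff)
  then have "Hm x ** transpose (\<Gamma>m c x) ** (G x ** Hm x) + (Hm x ** G x) ** \<Gamma>m c x ** Hm x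
      + (Hm x ** G x) ** pdiff_mat c Hm x = 0"
    by (simp only: metric_compat_mat[OF x] matrix_distribs matrix_mul_assoc)
  then show ?thesis
    by (simp add: HG GH[OF x] algebra_simps eq_neg_iff_add_eq_0)
qed

lemma inv_metric_compat: "x \<in> U \<Longrightarrow> pdiff c (h a b) x
    = - (\<Sum>k\<in>UNIV. \<Gamma> a c k x * h k b x) - (\<Sum>k\<in>UNIV. h a k x * \<Gamma> b c k x)"
  using inv_metric_compat_mat[of x c]
  by (simp add: vec_eq_iff pdiff_mat_def transpose_def \<Gamma>m_def Hm_def matrix_matrix_mult_def
     inv_metric_def[abs_def])

section \<open>The curvature tensor and its symmetries\<close>

lemma Rm_eq: "Rm c d y = pdiff_mat c (\<Gamma>m d) y - pdiff_mat d (\<Gamma>m c) y + \<Gamma>m c y ** \<Gamma>m d y - \<Gamma>m d y ** \<Gamma>m c y"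
  by (simp add: vec_eq_iff Rm_def riemann_up_def pdiff_mat_def \<Gamma>m_def matrix_matrix_mult_def sum_subtractf
      eta_contract_eq)

lemma riemann_up_antisym: "riemann_up G a b d c x = - riemann_up G a b c d x"
  by (simp add: riemann_up_def sum_subtractf)

lemma pdiff_\<Gamma>_sym: "x \<in> U \<Longrightarrow> pdiff d (\<Gamma> a b c) x = pdiff d (\<Gamma> a c b) x"
  by (rule pdiff_cong[OF open_U]) (auto intro: \<Gamma>_sym)

text \<open>First Bianchi identity: the connection is torsion free, so the terms cancel in pairs by
  the symmetry of the lower indices of \<Gamma>.\<close>

lemma riemann_up_cyclic:
  "x \<in> U \<Longrightarrow> riemann_up G a b c d x + riemann_up G a c d b x + riemann_up G a d b c x = 0"
  unfolding riemann_up_def sum_subtractf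
  using pdiff_\<Gamma>_sym[of x _ a b c] pdiff_\<Gamma>_sym[of x _ a b d] pdiff_\<Gamma>_sym[of x _ a c d]
    \<Gamma>_sym[of x _ b c] \<Gamma>_sym[of x _ b d] \<Gamma>_sym[of x _ c d]
  by simp

lemma riemann_antisym34: "riemann G a b d c x = - riemann G a b c d x"
  unfolding riemann_def riemann_up_antisym[of _ b d c] by (simp add: sum_negf)

lemma riemann_cyclic: "x \<in> U \<Longrightarrow> riemann G a b c d x + riemann G a c d b x + riemann G a d b c x = 0"
proof -
  assume x: "x \<in> U"
  have "riemann G a b c d x + riemann G a c d b x + riemann G a d b c x
     = (\<Sum>e\<in>UNIV. G x $ a $ e * (riemann_up G e b c d x + riemann_up G e c d b x + riemann_up G e d b c x))"
    by (simp add: riemann_def sum.distrib distrib_left)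
  then show ?thesis by (simp add: riemann_up_cyclic[OF x])
qed

text \<open>Antisymmetry in the first pair expresses that second partial derivatives of \<open>G\<close> commute.\<close>
lemma riemann_antisym12: "x \<in> U \<Longrightarrow> riemann G b a c d x = - riemann G a b c d x"
proof -
  assume x: "x \<in> U"
  have pp: "pdiff_mat d (pdiff_mat c G) x =
      transpose (pdiff_mat d (\<Gamma>m c) x) ** G x
      + transpose (\<Gamma>m c x) ** (transpose (\<Gamma>m d x) ** G x + G x ** \<Gamma>m d x)
      + ((transpose (\<Gamma>m d x) ** G x + G x ** \<Gamma>m d x) ** \<Gamma>m c x + G x ** pdiff_mat d (\<Gamma>m c) x)" for c d
  proof -
    have "pdiff_mat d (pdiff_mat c G) x = pdiff_mat d (\<lambda>y. transpose (\<Gamma>m c y) ** G y + G y ** \<Gamma>m c y) x"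
      by (rule pdiff_mat_cong[OF open_U x]) (rule metric_compat_mat)
    also have "\<dots> = pdiff_mat d (\<lambda>y. transpose (\<Gamma>m c y) ** G y) x + pdiff_mat d (\<lambda>y. G y ** \<Gamma>m c y) x"
      by (rule pdiff_mat_add[OF _ _ x]) (intro smooth_mat_intros open_U smooth_mats)+
    also have "pdiff_mat d (\<lambda>y. transpose (\<Gamma>m c y) ** G y) x =
       pdiff_mat d (\<lambda>y. transpose (\<Gamma>m c y)) x ** G x + transpose (\<Gamma>m c x) ** pdiff_mat d G x"
      by (rule pdiff_mat_mult[OF _ _ x]) (intro smooth_mat_intros smooth_mats)+
    also have "pdiff_mat d (\<lambda>y. G y ** \<Gamma>m c y) x = pdiff_mat d G x ** \<Gamma>m c x + G x ** pdiff_mat d (\<Gamma>m c) x"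
      by (rule pdiff_mat_mult[OF _ _ x]) (intro smooth_mats)+
    finally show ?thesis by (simp add: pdiff_mat_transpose metric_compat_mat[OF x])
  qed
  have "pdiff_mat c (pdiff_mat d G) x = pdiff_mat d (pdiff_mat c G) x"
    by (rule pdiff_mat_commute[OF open_U smooth_mats(1) x])
  \<comment> \<open>The terms with \<open>G\<close> between two connection matrices are symmetric in
    \<open>c\<close> and \<open>d\<close> and cancel; the others assemble to \<open>Rm c d\<close>
    acting on either index of \<open>G\<close>.\<close>
  then have "transpose (Rm c d x) ** G x + G x ** Rm c d x = 0"
    unfolding pp Rm_eq by (simp add: transpose_add transpose_diff matrix_transpose_mul matrix_distribs matrix_mul_assoc algebra_simps)
  then have "(transpose (Rm c d x) ** G x + G x ** Rm c d x) $ a $ b = 0" by simp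
  then show ?thesis
    by (simp add: matrix_matrix_mult_def transpose_def Rm_def riemann_def G_sym[OF x, of _ b] mult.commute
        add_eq_0_iff)
qed

text \<open>The classical combination of four cyclic identities with the two antisymmetries.\<close>

lemma riemann_pair_sym: "x \<in> U \<Longrightarrow> riemann G a b c d x = riemann G c d a b x"
  using riemann_cyclic[of x a b c d] riemann_cyclic[of x b c d a] riemann_cyclic[of x c d a b]
    riemann_cyclic[of x d a b c]
    riemann_antisym12[of x] riemann_antisym34[of _ _ _ _ x]
  by (smt (verit, best))

text \<open>Second Bianchi identity as the cyclic sum of dR + [\<Gamma>, R]. Second derivatives of
  the connection cancel because partial derivatives commute, the cubic terms as in the Jacobi
  identity. The Christoffel terms on \<open>c\<close>, \<open>d\<close>, \<open>e\<close> cancel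
  among themselves and are restored in \<open>bianchi\<close>.\<close>

lemma bianchi_mat:
  assumes x: "x \<in> U"
  shows "pdiff_mat e (Rm c d) x + \<Gamma>m e x ** Rm c d x - Rm c d x ** \<Gamma>m e x
    + (pdiff_mat c (Rm d e) x + \<Gamma>m c x ** Rm d e x - Rm d e x ** \<Gamma>m c x)
    + (pdiff_mat d (Rm e c) x + \<Gamma>m d x ** Rm e c x - Rm e c x ** \<Gamma>m d x) = 0"
proof -
  have pp: "pdiff_mat e (Rm c d) x = pdiff_mat e (pdiff_mat c (\<Gamma>m d)) x - pdiff_mat e (pdiff_mat d (\<Gamma>m c)) x
      + (pdiff_mat e (\<Gamma>m c) x ** \<Gamma>m d x + \<Gamma>m c x ** pdiff_mat e (\<Gamma>m d) x)
      - (pdiff_mat e (\<Gamma>m d) x ** \<Gamma>m c x + \<Gamma>m d x ** pdiff_mat e (\<Gamma>m c) x)" for c d e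
  proof -
    have "Rm c d = (\<lambda>y. pdiff_mat c (\<Gamma>m d) y - pdiff_mat d (\<Gamma>m c) y + \<Gamma>m c y ** \<Gamma>m d y - \<Gamma>m d y ** \<Gamma>m c y)"
      by (rule ext) (rule Rm_eq)
    then have "pdiff_mat e (Rm c d) x = pdiff_mat e (\<lambda>y. pdiff_mat c (\<Gamma>m d) y - pdiff_mat d (\<Gamma>m c) y
        + \<Gamma>m c y ** \<Gamma>m d y - \<Gamma>m d y ** \<Gamma>m c y) x"
      by (rule arg_cong)
    also have "\<dots> = pdiff_mat e (\<lambda>y. pdiff_mat c (\<Gamma>m d) y - pdiff_mat d (\<Gamma>m c) y + \<Gamma>m c y ** \<Gamma>m d y) x
        - pdiff_mat e (\<lambda>y. \<Gamma>m d y ** \<Gamma>m c y) x"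
      by (rule pdiff_mat_diff[OF _ _ x]) (intro smooth_mat_intros smooth_mats open_U)+
    also have "pdiff_mat e (\<lambda>y. pdiff_mat c (\<Gamma>m d) y - pdiff_mat d (\<Gamma>m c) y + \<Gamma>m c y ** \<Gamma>m d y) x
        = pdiff_mat e (\<lambda>y. pdiff_mat c (\<Gamma>m d) y - pdiff_mat d (\<Gamma>m c) y) x
            + pdiff_mat e (\<lambda>y. \<Gamma>m c y ** \<Gamma>m d y) x"
      by (rule pdiff_mat_add[OF _ _ x]) (intro smooth_mat_intros smooth_mats open_U)+
    also have "pdiff_mat e (\<lambda>y. pdiff_mat c (\<Gamma>m d) y - pdiff_mat d (\<Gamma>m c) y) x
        = pdiff_mat e (pdiff_mat c (\<Gamma>m d)) x - pdiff_mat e (pdiff_mat d (\<Gamma>m c)) x"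
      by (rule pdiff_mat_diff[OF _ _ x]) (intro smooth_mat_intros smooth_mats open_U)+
    finally show ?thesis by (simp add: pdiff_mat_mult[OF smooth_mats(2) smooth_mats(2) x])
  qed
  show ?thesis
    unfolding pp
    unfolding Rm_eq using pdiff_mat_commute[OF open_U smooth_mats(2) x, of e c d]
      pdiff_mat_commute[OF open_U smooth_mats(2) x, of e d c]
      pdiff_mat_commute[OF open_U smooth_mats(2) x, of d c e]
    by (simp add: matrix_distribs matrix_mul_assoc algebra_simps)
qed

end

section \<open>Covariant derivatives\<close>

definition ctensor2 :: "(4 \<Rightarrow> 4 \<Rightarrow> real^4 \<Rightarrow> real) \<Rightarrow> ctensor" where
  "ctensor2 T is x = (case is of [a, b] \<Rightarrow> T a b x | _ \<Rightarrow> 0)"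

lemma ctensor_simps [simp]:
  "ctensor0 f [] = f"
  "ctensor1 v [a] = v a"
  "ctensor2 S [a, b] = S a b"
  "ctensor4 T [a, b, c, d] = T a b c d"
  by (simp_all add: fun_eq_iff ctensor0_def ctensor1_def ctensor2_def ctensor4_def)

text \<open>A list of the wrong length gives the zero component, so smoothness holds for every list,
  the form that \<open>cov_deriv_add\<close> asks for.\<close>

lemma smooth_ctensor1: "(\<And>a. smooth_on U (v a)) \<Longrightarrow> smooth_on U (ctensor1 v js)"
proof (cases "\<exists>a. js = [a]")
  case False
  then have "ctensor1 v js = (\<lambda>y. 0)"
    by (auto simp: fun_eq_iff ctensor1_def split: list.split)
  then show ?thesis by (simp add: smooth_on_const)
qed auto

lemma smooth_ctensor2: "(\<And>a b. smooth_on U (T a b)) \<Longrightarrow> smooth_on U (ctensor2 T js)"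
proof (cases "\<exists>a b. js = [a, b]")
  case False
  then have "ctensor2 T js = (\<lambda>y. 0)"
    by (auto simp: fun_eq_iff ctensor2_def split: list.split)
  then show ?thesis by (simp add: smooth_on_const)
qed auto

lemma smooth_ctensor4: "(\<And>a b c d. smooth_on U (T a b c d)) \<Longrightarrow> smooth_on U (ctensor4 T js)"
proof (cases "\<exists>a b c d. js = [a, b, c, d]")
  case False
  then have "ctensor4 T js = (\<lambda>y. 0)"
    by (auto simp: fun_eq_iff ctensor4_def split: list.split)
  then show ?thesis by (simp add: smooth_on_const)
qed auto

lemma sum_swap_pairs:
  "(\<Sum>a\<in>A. \<Sum>b\<in>B. \<Sum>c\<in>C. \<Sum>d\<in>D. F a b c d) = (\<Sum>c\<in>C. \<Sum>d\<in>D. \<Sum>a\<in>A. \<Sum>b\<in>B. F a b c d)"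
proof -
  have "(\<Sum>a\<in>A. \<Sum>b\<in>B. \<Sum>c\<in>C. \<Sum>d\<in>D. F a b c d) = (\<Sum>a\<in>A. \<Sum>c\<in>C. \<Sum>d\<in>D. \<Sum>b\<in>B. F a b c d)"
    by (subst (2) sum.swap) (intro sum.cong refl sum.swap)
  also have "\<dots> = (\<Sum>c\<in>C. \<Sum>d\<in>D. \<Sum>a\<in>A. \<Sum>b\<in>B. F a b c d)"
    by (subst sum.swap) (intro sum.cong refl sum.swap)
  finally show ?thesis .
qed

section \<open>Covariant derivatives in a chart, and contraction\<close>

context chart_metric
begin

lemma cov_deriv_0: "cov_deriv G T [e] x = pdiff e (T []) x"
  by (simp add: cov_deriv_def)

lemma cov_deriv_1: "cov_deriv G T [e, a] x = pdiff e (T [a]) x - (\<Sum>d\<in>UNIV. \<Gamma> d e a x * T [d] x)"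
  by (simp add: cov_deriv_def)

lemma cov_deriv_2: "cov_deriv G T [e, a, b] x = pdiff e (T [a, b]) x
    - (\<Sum>d\<in>UNIV. \<Gamma> d e a x * T [d, b] x) - (\<Sum>d\<in>UNIV. \<Gamma> d e b x * T [a, d] x)"
  by (simp add: cov_deriv_def)

lemma cov_deriv_3: "cov_deriv G T [e, a, b, c] x = pdiff e (T [a, b, c]) x
    - (\<Sum>d\<in>UNIV. \<Gamma> d e a x * T [d, b, c] x) - (\<Sum>d\<in>UNIV. \<Gamma> d e b x * T [a, d, c] x)
    - (\<Sum>d\<in>UNIV. \<Gamma> d e c x * T [a, b, d] x)"
  by (simp add: cov_deriv_def)

lemma cov_deriv_4: "cov_deriv G T [f, a, b, c, d] x = pdiff f (T [a, b, c, d]) x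
    - (\<Sum>k\<in>UNIV. \<Gamma> k f a x * T [k, b, c, d] x) - (\<Sum>k\<in>UNIV. \<Gamma> k f b x * T [a, k, c, d] x)
    - (\<Sum>k\<in>UNIV. \<Gamma> k f c x * T [a, b, k, d] x) - (\<Sum>k\<in>UNIV. \<Gamma> k f d x * T [a, b, c, k] x)"
  by (simp add: cov_deriv_def)

lemma cov_deriv_add:
  assumes x: "x \<in> U" and "\<And>js. smooth_on U (S js)" "\<And>js. smooth_on U (T js)"
  shows "cov_deriv G (\<lambda>js y. S js y + T js y) (e # is) x = cov_deriv G S (e # is) x + cov_deriv G T (e # is) x"
  using assms(2,3)[THEN smooth_on_differentiable, OF x]
  by (simp add: cov_deriv_def pdiff_add sum.distrib distrib_left)

lemma cov_deriv_cmult: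
  assumes x: "x \<in> U" and "\<And>js. smooth_on U (S js)"
  shows "cov_deriv G (\<lambda>js y. k * S js y) (e # is) x = k * cov_deriv G S (e # is) x"
  using assms(2)[THEN smooth_on_differentiable, OF x]
  by (simp add: cov_deriv_def pdiff_cmult sum_distrib_left right_diff_distrib mult.left_commute)

text \<open>The first slot is contracted with the last: applied to a covariant derivative this is
  the divergence on the last index, as in
  \<open>\<nabla>\<^sup>d C\<^sub>a\<^sub>c\<^sub>b\<^sub>d\<close>.\<close>

definition contr :: "ctensor \<Rightarrow> ctensor" where
  "contr T is x = (\<Sum>f\<in>UNIV. \<Sum>d\<in>UNIV. h f d x * T (f # is @ [d]) x)"

text \<open>Contraction commutes with the covariant derivative because the inverse metric is
  parallel.\<close>

lemma cov_deriv_contr: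
  assumes x: "x \<in> U" and T: "\<And>js. length js = Suc (Suc (length is)) \<Longrightarrow> smooth_on U (T js)"
  shows "cov_deriv G (contr T) (e # is) x
    = (\<Sum>f\<in>UNIV. \<Sum>d\<in>UNIV. h f d x * cov_deriv G T (e # f # is @ [d]) x)"
proof -
  have dT: "T (f # is @ [d]) differentiable (at x)" for f d
    by (rule smooth_on_differentiable[OF T x]) simp
  have dh: "h f d differentiable (at x)" for f d
    by (rule smooth_on_differentiable[OF smooth_h x])
  let ?n = "length is"
  \<comment> \<open>The correction sum is split into the slot of \<open>f\<close>, the slots of
    \<open>is\<close> and the slot of \<open>d\<close>.\<close>
  have *: "cov_deriv G T (e # f # is @ [d]) x = pdiff e (T (f # is @ [d])) x
      - (\<Sum>b\<in>UNIV. \<Gamma> b e f x * T (b # is @ [d]) x)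
      - (\<Sum>k<?n. \<Sum>b\<in>UNIV. \<Gamma> b e (is ! k) x * T (f # is[k := b] @ [d]) x)
      - (\<Sum>b\<in>UNIV. \<Gamma> b e d x * T (f # is @ [b]) x)" for f d
    by (simp add: cov_deriv_def sum.lessThan_Suc_shift[of _ "Suc ?n"] nth_append list_update_append
        del: sum.lessThan_Suc) (simp add: nth_append list_update_append)
  have 1: "pdiff e (contr T is) x = (\<Sum>f\<in>UNIV. \<Sum>d\<in>UNIV. pdiff e (h f d) x * T (f # is @ [d]) x
      + h f d x * pdiff e (T (f # is @ [d])) x)"
    unfolding contr_def[abs_def] by (simp add: pdiff_sum pdiff_mult dT dh)
  \<comment> \<open>By \<open>inv_metric_compat\<close> the derivative of \<open>h\<close> supplies
    exactly the corrections for the two contracted slots.\<close>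
  have 2: "(\<Sum>f\<in>UNIV. \<Sum>d\<in>UNIV. pdiff e (h f d) x * T (f # is @ [d]) x)
     = - (\<Sum>f\<in>UNIV. \<Sum>d\<in>UNIV. h f d x * (\<Sum>b\<in>UNIV. \<Gamma> b e f x * T (b # is @ [d]) x))
       - (\<Sum>f\<in>UNIV. \<Sum>d\<in>UNIV. h f d x * (\<Sum>b\<in>UNIV. \<Gamma> b e d x * T (f # is @ [b]) x))"
  proof -
    have "(\<Sum>f\<in>UNIV. \<Sum>d\<in>UNIV. \<Sum>b\<in>UNIV. \<Gamma> f e b x * h b d x * T (f # is @ [d]) x)
        = (\<Sum>f\<in>UNIV. \<Sum>b\<in>UNIV. \<Sum>d\<in>UNIV. \<Gamma> f e b x * h b d x * T (f # is @ [d]) x)"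
      by (rule sum.cong[OF refl], rule sum.swap)
    also have "\<dots> = (\<Sum>b\<in>UNIV. \<Sum>f\<in>UNIV. \<Sum>d\<in>UNIV. \<Gamma> f e b x * h b d x * T (f # is @ [d]) x)"
      by (rule sum.swap)
    also have "\<dots> = (\<Sum>b\<in>UNIV. \<Sum>d\<in>UNIV. \<Sum>f\<in>UNIV. \<Gamma> f e b x * h b d x * T (f # is @ [d]) x)"
      by (rule sum.cong[OF refl], rule sum.swap)
    also have "\<dots> = (\<Sum>f\<in>UNIV. \<Sum>d\<in>UNIV. h f d x * (\<Sum>b\<in>UNIV. \<Gamma> b e f x * T (b # is @ [d]) x))"
      by (simp add: sum_distrib_left mult_ac)
    finally have A: "(\<Sum>f\<in>UNIV. \<Sum>d\<in>UNIV. \<Sum>b\<in>UNIV. \<Gamma> f e b x * h b d x * T (f # is @ [d]) x)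
      = (\<Sum>f\<in>UNIV. \<Sum>d\<in>UNIV. h f d x * (\<Sum>b\<in>UNIV. \<Gamma> b e f x * T (b # is @ [d]) x))" .
    have B: "(\<Sum>f\<in>UNIV. \<Sum>d\<in>UNIV. \<Sum>b\<in>UNIV. h f b x * \<Gamma> d e b x * T (f # is @ [d]) x)
      = (\<Sum>f\<in>UNIV. \<Sum>d\<in>UNIV. h f d x * (\<Sum>b\<in>UNIV. \<Gamma> b e d x * T (f # is @ [b]) x))"
      unfolding sum_distrib_left by (rule sum.cong[OF refl], subst sum.swap, simp add: mult_ac)
    show ?thesis unfolding A[symmetric] B[symmetric]
      by (simp add: inv_metric_compat[OF x] left_diff_distrib sum_subtractf sum_distrib_right sum_negf)
  qed
  have 3: "(\<Sum>k<?n. \<Sum>b\<in>UNIV. \<Gamma> b e (is ! k) x * contr T (is[k := b]) x)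
     = (\<Sum>f\<in>UNIV. \<Sum>d\<in>UNIV. h f d x * (\<Sum>k<?n. \<Sum>b\<in>UNIV. \<Gamma> b e (is ! k) x * T (f # is[k := b] @ [d]) x))"
  proof -
    have "(\<Sum>k<?n. \<Sum>b\<in>UNIV. \<Gamma> b e (is ! k) x * contr T (is[k := b]) x)
      = (\<Sum>k<?n. \<Sum>b\<in>UNIV. \<Sum>f\<in>UNIV. \<Sum>d\<in>UNIV. \<Gamma> b e (is ! k) x * (h f d x * T (f # is[k := b] @ [d]) x))"
      by (simp add: contr_def sum_distrib_left)
    also note sum_swap_pairs
    finally show ?thesis by (simp add: sum_distrib_left mult.left_commute)
  qed
  have "cov_deriv G (contr T) (e # is) x = pdiff e (contr T is) x
      - (\<Sum>k<?n. \<Sum>b\<in>UNIV. \<Gamma> b e (is ! k) x * contr T (is[k := b]) x)"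
    by (simp add: cov_deriv_def)
  then show ?thesis
    unfolding 1 3 * by (simp add: sum.distrib 2 right_diff_distrib sum_subtractf)
qed

section \<open>The second Bianchi identity and its contractions\<close>

text \<open>\<open>\<nabla>\<^sub>e R\<^sup>a\<^sub>b\<^sub>c\<^sub>d\<close>: type \<open>ctensor\<close> only covers lower indices.\<close>
definition DR :: "4 \<Rightarrow> 4 \<Rightarrow> 4 \<Rightarrow> 4 \<Rightarrow> 4 \<Rightarrow> real^4 \<Rightarrow> real" where
  "DR e a b c d x = pdiff e (riemann_up G a b c d) x
     + (\<Sum>f\<in>UNIV. \<Gamma> a e f x * riemann_up G f b c d x) - (\<Sum>f\<in>UNIV. \<Gamma> f e b x * riemann_up G a f c d x)
     - (\<Sum>f\<in>UNIV. \<Gamma> f e c x * riemann_up G a b f d x) - (\<Sum>f\<in>UNIV. \<Gamma> f e d x * riemann_up G a b c f x)"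

lemma DR_antisym: "x \<in> U \<Longrightarrow> DR e a b d c x = - DR e a b c d x"
proof -
  assume x: "x \<in> U"
  have "riemann_up G a b d c = (\<lambda>y. - riemann_up G a b c d y)"
    by (rule ext) (rule riemann_up_antisym)
  then show ?thesis
    unfolding DR_def riemann_up_antisym[of _ _ d c] riemann_up_antisym[of _ _ _ c] riemann_up_antisym[of _ _ d _]
    by (simp add: pdiff_minus smooth_on_differentiable[OF smooth_riemann_up x] sum_negf)
qed

lemma bianchi:
  assumes x: "x \<in> U"
  shows "DR e a b c d x + DR c a b d e x + DR d a b e c x = 0"
proof -
  have E: "(pdiff_mat e (Rm c d) x + \<Gamma>m e x ** Rm c d x - Rm c d x ** \<Gamma>m e x) $ a $ b
     = DR e a b c d x + (\<Sum>f\<in>UNIV. \<Gamma> f e c x * riemann_up G a b f d x)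
         + (\<Sum>f\<in>UNIV. \<Gamma> f e d x * riemann_up G a b c f x)"
    for e c d
    by (simp add: DR_def pdiff_mat_def Rm_def \<Gamma>m_def matrix_matrix_mult_def mult.commute eta_contract_eq)
  \<comment> \<open>Symmetry of \<Gamma> meets antisymmetry of the curvature: each extra Christoffel
    term of one cyclic summand cancels one of another.\<close>
  have Z: "(\<Sum>f\<in>UNIV. \<Gamma> f e c x * riemann_up G a b f d x) = - (\<Sum>f\<in>UNIV. \<Gamma> f c e x * riemann_up G a b d f x)"
      for e c d
    by (simp add: riemann_up_antisym[of _ _ d] \<Gamma>_sym[OF x, of _ c e] sum_negf)
  show ?thesis
    using arg_cong[OF bianchi_mat[OF x, of e c d], of "\<lambda>M. M $ a $ b"] E[of e c d] E[of c d e] E[of d e c]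
      Z[of e c d] Z[of c d e] Z[of d e c]
    by simp
qed

text \<open>Lowering commutes with the covariant derivative: by metric compatibility the derivative
  of \<open>G\<close> yields the corrections both for the lowered \<open>a\<close> and for the upper
  \<open>k\<close>.\<close>

lemma cov_deriv_riemann:
  assumes x: "x \<in> U"
  shows "cov_deriv G (ctensor4 (riemann G)) [e, a, b, c, d] x = (\<Sum>k\<in>UNIV. G x $ a $ k * DR e k b c d x)"
proof -
  note D = smooth_on_differentiable[OF smooth_riemann_up x] smooth_on_differentiable[OF smooth_G x]
  have 1: "pdiff e (riemann G a b c d) x = (\<Sum>k\<in>UNIV. pdiff e (\<lambda>y. G y $ a $ k) x * riemann_up G k b c d x
      + G x $ a $ k * pdiff e (riemann_up G k b c d) x)"
    unfolding riemann_def[abs_def] by (simp add: pdiff_sum pdiff_mult D)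
  have 2: "(\<Sum>k\<in>UNIV. pdiff e (\<lambda>y. G y $ a $ k) x * riemann_up G k b c d x)
     = (\<Sum>f\<in>UNIV. \<Gamma> f e a x * riemann G f b c d x)
      + (\<Sum>k\<in>UNIV. G x $ a $ k * (\<Sum>f\<in>UNIV. \<Gamma> k e f x * riemann_up G f b c d x))"
  proof -
    have "(\<Sum>k\<in>UNIV. \<Sum>f\<in>UNIV. \<Gamma> f e a x * G x $ f $ k * riemann_up G k b c d x)
        = (\<Sum>f\<in>UNIV. \<Sum>k\<in>UNIV. \<Gamma> f e a x * G x $ f $ k * riemann_up G k b c d x)"
      "(\<Sum>k\<in>UNIV. \<Sum>f\<in>UNIV. G x $ a $ f * \<Gamma> f e k x * riemann_up G k b c d x)
        = (\<Sum>f\<in>UNIV. \<Sum>k\<in>UNIV. G x $ a $ f * \<Gamma> f e k x * riemann_up G k b c d x)"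
      by (rule sum.swap)+
    then show ?thesis
      by (simp add: metric_compat[OF x] distrib_right sum.distrib sum_distrib_left sum_distrib_right
          riemann_def mult.assoc)
  qed
  have 3: "(\<Sum>k\<in>UNIV. F k * riemann G a k c d x)
      = (\<Sum>k\<in>UNIV. G x $ a $ k * (\<Sum>f\<in>UNIV. F f * riemann_up G k f c d x))"
    "(\<Sum>k\<in>UNIV. F k * riemann G a b k d x) = (\<Sum>k\<in>UNIV. G x $ a $ k * (\<Sum>f\<in>UNIV. F f * riemann_up G k b f d x))"
    "(\<Sum>k\<in>UNIV. F k * riemann G a b c k x)
        = (\<Sum>k\<in>UNIV. G x $ a $ k * (\<Sum>f\<in>UNIV. F f * riemann_up G k b c f x))" for F
    unfolding riemann_def sum_distrib_left by (subst sum.swap, simp add: mult_ac)+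
  show ?thesis
    unfolding cov_deriv_4 ctensor_simps 1 sum.distrib 2 3
    by (simp add: DR_def right_diff_distrib distrib_left sum.distrib sum_subtractf)
qed

lemma DR_trace:
  assumes x: "x \<in> U"
  shows "(\<Sum>a\<in>UNIV. DR e a b a d x) = cov_deriv G (ctensor2 (ricci G)) [e, b, d] x"
proof -
  have 1: "pdiff e (ricci G b d) x = (\<Sum>a\<in>UNIV. pdiff e (riemann_up G a b a d) x)"
    unfolding ricci_def[abs_def] by (simp add: pdiff_sum smooth_on_differentiable[OF smooth_riemann_up x])
  \<comment> \<open>The corrections of the two traced slots agree after renaming and enter
    \<open>DR\<close> with opposite signs.\<close>
  have 2: "(\<Sum>a\<in>UNIV. \<Sum>f\<in>UNIV. \<Gamma> f e a x * riemann_up G a b f d x)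
     = (\<Sum>a\<in>UNIV. \<Sum>f\<in>UNIV. \<Gamma> a e f x * riemann_up G f b a d x)"
    by (rule sum.swap)
  have 3: "(\<Sum>f\<in>UNIV. F f * ricci G f d x) = (\<Sum>a\<in>UNIV. \<Sum>f\<in>UNIV. F f * riemann_up G a f a d x)"
    "(\<Sum>f\<in>UNIV. F f * ricci G b f x) = (\<Sum>a\<in>UNIV. \<Sum>f\<in>UNIV. F f * riemann_up G a b a f x)" for F
    unfolding ricci_def sum_distrib_left by (rule sum.swap)+
  show ?thesis
    unfolding cov_deriv_2 ctensor_simps 1 3 by (simp add: DR_def sum.distrib sum_subtractf 2)
qed

text \<open>Trace the upper index with the derivative index \<open>f\<close>. In the other two
  summands the trace falls on the curvature itself and gives the Ricci tensor.\<close>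

lemma bianchi_contracted:
  assumes x: "x \<in> U"
  shows "(\<Sum>f\<in>UNIV. DR f f b c a x)
    = cov_deriv G (ctensor2 (ricci G)) [c, b, a] x - cov_deriv G (ctensor2 (ricci G)) [a, b, c] x"
proof -
  have "(\<Sum>f\<in>UNIV. DR f f b c a x + DR c f b a f x + DR a f b f c x) = 0"
    by (simp add: bianchi[OF x])
  then have "(\<Sum>f\<in>UNIV. DR f f b c a x) - (\<Sum>f\<in>UNIV. DR c f b f a x) + (\<Sum>f\<in>UNIV. DR a f b f c x) = 0"
    by (simp add: DR_antisym[OF x, of c _ b a] sum.distrib sum_subtractf)
  then show ?thesis by (simp add: DR_trace[OF x])
qed

text \<open>The first identity brings the last index into the first slot, the one that
  \<open>DR_raise\<close> raises; the second flips both pairs at once, as \<open>div_ricci\<close>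
  needs.\<close>

lemma cov_deriv_riemann_sym:
  assumes x: "x \<in> U"
  shows "cov_deriv G (ctensor4 (riemann G)) [f, a, c, b, d] x =
      - cov_deriv G (ctensor4 (riemann G)) [f, d, b, a, c] x"
    "cov_deriv G (ctensor4 (riemann G)) [f, c, a, d, b] x
        = cov_deriv G (ctensor4 (riemann G)) [f, a, c, b, d] x"
proof -
  have R: "riemann G a c b d y = - riemann G d b a c y" "riemann G c a d b y = riemann G a c b d y"
    if "y \<in> U" for a b c d y
    using riemann_pair_sym[OF that, of a c b d] riemann_antisym12[OF that, of d b a c]
      riemann_antisym12[OF that, of a c] riemann_antisym34[of a c d b y] by simp_all
  have p: "pdiff f (riemann G a c b d) x = - pdiff f (riemann G d b a c) x"
    by (subst pdiff_minus[symmetric], rule smooth_on_differentiable[OF smooth_riemann x],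
      rule pdiff_cong[OF open_U x], rule R)
  have q: "pdiff f (riemann G c a d b) x = pdiff f (riemann G a c b d) x"
    by (rule pdiff_cong[OF open_U x]) (rule R)
  show "cov_deriv G (ctensor4 (riemann G)) [f, a, c, b, d] x =
      - cov_deriv G (ctensor4 (riemann G)) [f, d, b, a, c] x"
    unfolding cov_deriv_4 ctensor_simps p R(1)[OF x, of a c b] R(1)[OF x, of a c _ d] R(1)[OF x, of a _ b d] R(1)[OF x, of _ c b d]
    by (simp add: sum_negf)
  show "cov_deriv G (ctensor4 (riemann G)) [f, c, a, d, b] x
      = cov_deriv G (ctensor4 (riemann G)) [f, a, c, b, d] x"
    unfolding cov_deriv_4 ctensor_simps q R(2)[OF x] by simp
qed

lemma DR_raise:
  assumes x: "x \<in> U"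
  shows "DR e k b c d x = (\<Sum>a\<in>UNIV. h k a x * cov_deriv G (ctensor4 (riemann G)) [e, a, b, c, d] x)"
  by (simp add: cov_deriv_riemann[OF x] raise_lower[OF x])

lemma div_riemann:
  assumes x: "x \<in> U"
  shows "contr (cov_deriv G (ctensor4 (riemann G))) [a, c, b] x
    = cov_deriv G (ctensor2 (ricci G)) [c, b, a] x - cov_deriv G (ctensor2 (ricci G)) [a, b, c] x"
  unfolding contr_def
  by (simp add: cov_deriv_riemann_sym(1)[OF x, of _ a c b] sum_negf DR_raise[OF x, symmetric]
     bianchi_contracted[OF x])

lemma div_ricci:
  assumes x: "x \<in> U"
  shows "2 * (\<Sum>a\<in>UNIV. \<Sum>b\<in>UNIV. h a b x * cov_deriv G (ctensor2 (ricci G)) [a, b, c] x)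
    = pdiff c (scalar_curv G) x"
proof -
  let ?R = "cov_deriv G (ctensor4 (riemann G))" and ?Ric = "cov_deriv G (ctensor2 (ricci G))"
  let ?X = "\<Sum>a\<in>UNIV. \<Sum>b\<in>UNIV. h a b x * ?Ric [a, b, c] x"
  have 1: "(\<Sum>b\<in>UNIV. h a b x * ?R [f, b, k, a, c] x) = DR f a k a c x" for a f k
    by (simp add: DR_raise[OF x])
  \<comment> \<open>A second trace of the contracted identity: performing the sum over
    \<open>a\<close> and \<open>b\<close> first turns the left side into the divergence of the Ricci
    tensor.\<close>
  have "(\<Sum>a\<in>UNIV. \<Sum>b\<in>UNIV. h a b x * (\<Sum>f\<in>UNIV. DR f f b c a x))
     = (\<Sum>a\<in>UNIV. \<Sum>b\<in>UNIV. \<Sum>f\<in>UNIV. \<Sum>k\<in>UNIV. h a b x * (h f k x * ?R [f, b, k, a, c] x))"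
    by (simp add: DR_raise[OF x] cov_deriv_riemann_sym(2)[OF x, of _ _ _ c] sum_distrib_left)
  also have "\<dots> = (\<Sum>f\<in>UNIV. \<Sum>k\<in>UNIV. \<Sum>a\<in>UNIV. \<Sum>b\<in>UNIV. h a b x * (h f k x * ?R [f, b, k, a, c] x))"
    by (rule sum_swap_pairs)
  also have "\<dots> = (\<Sum>f\<in>UNIV. \<Sum>k\<in>UNIV. h f k x * (\<Sum>a\<in>UNIV. \<Sum>b\<in>UNIV. h a b x * ?R [f, b, k, a, c] x))"
    by (simp add: sum_distrib_left mult_ac)
  also have "\<dots> = ?X"
    by (simp add: 1 DR_trace[OF x])
  finally have A: "(\<Sum>a\<in>UNIV. \<Sum>b\<in>UNIV. h a b x * (\<Sum>f\<in>UNIV. DR f f b c a x)) = ?X" .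
  have s: "contr (ctensor2 (ricci G)) [] = scalar_curv G"
    by (simp add: fun_eq_iff contr_def scalar_curv_def)
  have "pdiff c (scalar_curv G) x = cov_deriv G (contr (ctensor2 (ricci G))) [c] x"
    by (simp add: cov_deriv_0 s)
  also have "\<dots> = (\<Sum>a\<in>UNIV. \<Sum>b\<in>UNIV. h a b x * ?Ric [c, a, b] x)"
    by (subst cov_deriv_contr[OF x]) (simp_all add: smooth_ctensor2 smooth_ricci)
  also have "\<dots> = (\<Sum>a\<in>UNIV. \<Sum>b\<in>UNIV. h a b x * ?Ric [c, b, a] x)"
    by (subst sum.swap) (simp add: h_sym[OF x])
  finally have B: "pdiff c (scalar_curv G) x = (\<Sum>a\<in>UNIV. \<Sum>b\<in>UNIV. h a b x * ?Ric [c, b, a] x)" .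
  have "(\<Sum>a\<in>UNIV. \<Sum>b\<in>UNIV. h a b x * ?Ric [c, b, a] x) - ?X = ?X"
    using A by (simp add: bianchi_contracted[OF x] right_diff_distrib sum_subtractf)
  then show ?thesis using B by simp
qed

lemma ricci_riemann: "x \<in> U \<Longrightarrow> ricci G b d x = (\<Sum>a\<in>UNIV. \<Sum>c\<in>UNIV. h a c x * riemann G c b a d x)"
  by (simp add: ricci_def riemann_def raise_lower)

lemma ricci_sym: "x \<in> U \<Longrightarrow> ricci G a b x = ricci G b a x"
proof -
  assume x: "x \<in> U"
  have "ricci G a b x = (\<Sum>c\<in>UNIV. \<Sum>d\<in>UNIV. h d c x * riemann G c b d a x)"
    unfolding ricci_riemann[OF x] using riemann_pair_sym[OF x] h_sym[OF x] by (intro sum.cong refl) metis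
  also have "\<dots> = ricci G b a x"
    unfolding ricci_riemann[OF x] by (rule sum.swap)
  finally show ?thesis .
qed

section \<open>Parallel metric, Leibniz rules and the commutator of covariant derivatives\<close>

lemma cov_deriv_metric: "x \<in> U \<Longrightarrow> cov_deriv G (ctensor2 (\<lambda>a b y. G y $ a $ b)) [e, a, b] x = 0"
  by (simp add: cov_deriv_2 metric_compat mult.commute)

text \<open>The terms that distinguish Weyl from Riemann are products with index patterns ac, bd or
  ad, bc; each pattern gets its own Leibniz rule.\<close>

lemma cov_deriv_prod_13_24:
  assumes x: "x \<in> U" and P: "\<And>a b. smooth_on U (P a b)" and Q: "\<And>a b. smooth_on U (Q a b)"
  shows "cov_deriv G (ctensor4 (\<lambda>a b c d y. P a c y * Q b d y)) [f, a, b, c, d] x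
    = cov_deriv G (ctensor2 P) [f, a, c] x * Q b d x + P a c x * cov_deriv G (ctensor2 Q) [f, b, d] x"
  unfolding cov_deriv_4 cov_deriv_2 ctensor_simps
    pdiff_mult[OF smooth_on_differentiable[OF P x] smooth_on_differentiable[OF Q x]]
  by (simp add: algebra_simps sum_distrib_left sum_distrib_right)

lemma cov_deriv_prod_14_23:
  assumes x: "x \<in> U" and P: "\<And>a b. smooth_on U (P a b)" and Q: "\<And>a b. smooth_on U (Q a b)"
  shows "cov_deriv G (ctensor4 (\<lambda>a b c d y. P a d y * Q b c y)) [f, a, b, c, d] x
    = cov_deriv G (ctensor2 P) [f, a, d] x * Q b c x + P a d x * cov_deriv G (ctensor2 Q) [f, b, c] x"
  unfolding cov_deriv_4 cov_deriv_2 ctensor_simps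
    pdiff_mult[OF smooth_on_differentiable[OF P x] smooth_on_differentiable[OF Q x]]
  by (simp add: algebra_simps sum_distrib_left sum_distrib_right)

text \<open>The sign is the one for a covector. Second partial derivatives commute, terms with first
  derivatives of \<open>v\<close> cancel by the symmetry of \<Gamma>, and the factor of
  \<open>v\<close> that remains is the curvature.\<close>

lemma ricci_identity:
  assumes x: "x \<in> U" and v: "\<And>a. smooth_on U (v a)"
  shows "cov_deriv G (cov_deriv G (ctensor1 v)) [e, a, b] x - cov_deriv G (cov_deriv G (ctensor1 v)) [a, e, b] x
    = - (\<Sum>d\<in>UNIV. riemann_up G d b e a x * v d x)"
proof -
  have D: "pdiff e (cov_deriv G (ctensor1 v) [a, b]) x = pdiff e (pdiff a (v b)) x
     - (\<Sum>d\<in>UNIV. pdiff e (\<Gamma> d a b) x * v d x + \<Gamma> d a b x * pdiff e (v d) x)" for e a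
  proof -
    have "cov_deriv G (ctensor1 v) [a, b] = (\<lambda>y. pdiff a (v b) y - (\<Sum>d\<in>UNIV. \<Gamma> d a b y * v d y))"
      by (rule ext) (simp add: cov_deriv_1)
    then show ?thesis
      by (simp add: pdiff_diff pdiff_sum pdiff_mult smooth_on_differentiable[OF v x]
          smooth_on_differentiable[OF smooth_\<Gamma> x] smooth_on_differentiable[OF smooth_on_pdiff[OF v] x])
  qed
  have 1: "(\<Sum>d\<in>UNIV. \<Gamma> d e b x * (\<Sum>k\<in>UNIV. \<Gamma> k a d x * v k x))
      = (\<Sum>d\<in>UNIV. (\<Sum>k\<in>UNIV. \<Gamma> d a k x * \<Gamma> k e b x) * v d x)" for a e
    by (simp add: sum_distrib_left sum_distrib_right) (subst sum.swap, simp add: mult_ac)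
  show ?thesis
    unfolding cov_deriv_2 D cov_deriv_1 ctensor_simps
    by (simp add: right_diff_distrib left_diff_distrib distrib_right sum_subtractf 1 sum.distrib riemann_up_def
        \<Gamma>_sym[OF x, of _ e a] pdiff_commute[OF open_U v x, of e a])
qed

end

section \<open>Ricci tensors of pure radiation form\<close>

lemma sum_product_13_24:
  fixes P Q :: "'a \<Rightarrow> 'a \<Rightarrow> real"
  shows "(\<Sum>a\<in>A. \<Sum>b\<in>A. \<Sum>c\<in>A. \<Sum>d\<in>A. s a * t b * u c * v d * (P a c * Q b d))
    = (\<Sum>a\<in>A. \<Sum>c\<in>A. P a c * s a * u c) * (\<Sum>b\<in>A. \<Sum>d\<in>A. Q b d * t b * v d)"
  by (simp add: sum_product mult_ac)

lemma sum_product_14_23: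
  fixes P Q :: "'a \<Rightarrow> 'a \<Rightarrow> real"
  shows "(\<Sum>a\<in>A. \<Sum>b\<in>A. \<Sum>c\<in>A. \<Sum>d\<in>A. s a * t b * u c * v d * (P a d * Q b c))
    = (\<Sum>a\<in>A. \<Sum>d\<in>A. P a d * s a * v d) * (\<Sum>b\<in>A. \<Sum>c\<in>A. Q b c * t b * u c)"
proof -
  have "(\<Sum>a\<in>A. \<Sum>b\<in>A. \<Sum>c\<in>A. \<Sum>d\<in>A. s a * t b * u c * v d * (P a d * Q b c))
     = (\<Sum>a\<in>A. \<Sum>b\<in>A. \<Sum>d\<in>A. \<Sum>c\<in>A. s a * t b * v d * u c * (P a d * Q b c))"
    by (subst (3) sum.swap) (simp add: mult_ac)
  then show ?thesis by (simp only: sum_product_13_24)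
qed

lemma sum_sum_rank_one:
  fixes m :: "'a \<Rightarrow> real"
  shows "(\<Sum>a\<in>A. \<Sum>b\<in>A. m a * m b * (P a * Q b)) = (\<Sum>a\<in>A. m a * P a) * (\<Sum>b\<in>A. m b * Q b)"
  by (simp add: sum_product mult_ac)

context chart_metric
begin

lemma contract_G: "x \<in> U \<Longrightarrow> (\<Sum>f\<in>UNIV. \<Sum>d\<in>UNIV. h f d x * (G x $ a $ d * X f)) = X a"
proof -
  assume x: "x \<in> U"
  have "(\<Sum>f\<in>UNIV. \<Sum>d\<in>UNIV. h f d x * (G x $ a $ d * X f)) = (\<Sum>f\<in>UNIV. (\<Sum>d\<in>UNIV. G x $ a $ d * h d f x) * X f)"
    by (simp add: sum_distrib_left h_sym[OF x] mult_ac)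
  also have "\<dots> = (\<Sum>f\<in>UNIV. if a = f then X f else 0)"
    by (rule sum.cong) (simp_all add: G_h[OF x])
  finally show ?thesis by simp
qed

lemma trace_metric: "x \<in> U \<Longrightarrow> (\<Sum>a\<in>UNIV. \<Sum>b\<in>UNIV. h a b x * G x $ a $ b) = 4"
proof -
  assume x: "x \<in> U"
  have "(\<Sum>a\<in>UNIV. \<Sum>b\<in>UNIV. h a b x * G x $ a $ b) = (\<Sum>a\<in>UNIV. \<Sum>b\<in>UNIV. h a b x * G x $ b $ a)"
    using G_sym[OF x] by (intro sum.cong refl) metis
  then show ?thesis by (simp add: h_G[OF x])
qed

lemma cov_deriv_ricci_sym:
  assumes x: "x \<in> U"
  shows "cov_deriv G (ctensor2 (ricci G)) [f, a, b] x = cov_deriv G (ctensor2 (ricci G)) [f, b, a] x"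
proof -
  have "pdiff f (ricci G a b) x = pdiff f (ricci G b a) x"
    by (rule pdiff_cong[OF open_U x]) (rule ricci_sym)
  then show ?thesis by (simp add: cov_deriv_2 ricci_sym[OF x, of a] ricci_sym[OF x, of b])
qed

lemma weyl_antisym12: "x \<in> U \<Longrightarrow> weyl G b a c d x = - weyl G a b c d x"
  by (simp add: weyl_def riemann_antisym12[of x b a] algebra_simps)

lemma weyl_antisym34: "weyl G a b d c x = - weyl G a b c d x"
  by (simp add: weyl_def riemann_antisym34[of a b d c] algebra_simps)

text \<open>In dimension 4 the trace has Ricci coefficient 1 - (4 - 2)/2 = 0, and its coefficient of
  the scalar curvature times the metric is -1/2 + (4 - 1)/6 = 0. Hence the \<Lambda> part of the
  Ricci tensor does not contribute to the Bach tensor.\<close>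

lemma weyl_trace:
  assumes x: "x \<in> U"
  shows "(\<Sum>c\<in>UNIV. \<Sum>d\<in>UNIV. h c d x * weyl G a c b d x) = 0"
proof -
  let ?G = "G x" and ?R = "\<lambda>a b. ricci G a b x"
  have 1: "(\<Sum>c\<in>UNIV. \<Sum>d\<in>UNIV. h c d x * riemann G a c b d x) = ?R a b"
  proof -
    have "riemann G a c b d x = riemann G d b c a x" for c d
      using riemann_pair_sym[OF x, of a c b d] riemann_antisym12[OF x, of b d a c] riemann_antisym34[of d b a c x]
      by simp
    then show ?thesis by (simp add: ricci_riemann[OF x, of b a] ricci_sym[OF x, of a b])
  qed
  have 2: "(\<Sum>c\<in>UNIV. \<Sum>d\<in>UNIV. h c d x * (?G $ a $ d * F c)) = F a" for F a
    by (rule contract_G[OF x])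
  have 3: "(\<Sum>c\<in>UNIV. \<Sum>d\<in>UNIV. h c d x * (?G $ c $ b * F d)) = F b" for F b
    using contract_G[OF x, of b F]
        by (subst sum.swap) (simp add: h_sym[OF x, of _ b] G_sym[OF x, of _ b] h_sym[OF x])
  have 4: "(\<Sum>c\<in>UNIV. \<Sum>d\<in>UNIV. h c d x * (k * ?G $ c $ d)) = 4 * k" for k
    using trace_metric[OF x] by (simp add: mult.left_commute flip: sum_distrib_left)
  have 5: "(\<Sum>c\<in>UNIV. \<Sum>d\<in>UNIV. h c d x * (k * ?R c d)) = k * scalar_curv G x" for k
    by (simp add: scalar_curv_def mult.left_commute flip: sum_distrib_left)
  have "(\<Sum>c\<in>UNIV. \<Sum>d\<in>UNIV. h c d x * weyl G a c b d x) = (\<Sum>c\<in>UNIV. \<Sum>d\<in>UNIV. h c d x * riemann G a c b d x)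
     - 1/2 * (\<Sum>c\<in>UNIV. \<Sum>d\<in>UNIV. h c d x * (?G $ a $ b * ?R c d))
     + 1/2 * (\<Sum>c\<in>UNIV. \<Sum>d\<in>UNIV. h c d x * (?G $ a $ d * ?R c b))
     - 1/2 * (\<Sum>c\<in>UNIV. \<Sum>d\<in>UNIV. h c d x * (?R a b * ?G $ c $ d))
     + 1/2 * (\<Sum>c\<in>UNIV. \<Sum>d\<in>UNIV. h c d x * (?G $ c $ b * ?R a d))
     + 1/6 * scalar_curv G x * (\<Sum>c\<in>UNIV. \<Sum>d\<in>UNIV. h c d x * (?G $ a $ b * ?G $ c $ d))
     - 1/6 * scalar_curv G x * (\<Sum>c\<in>UNIV. \<Sum>d\<in>UNIV. h c d x * (?G $ a $ d * ?G $ c $ b))"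
    by (simp only: sum_distrib_left sum.distrib[symmetric] sum_subtractf[symmetric])
      (simp add: weyl_def algebra_simps)
  then show ?thesis
    unfolding 1 2 3 4 5 by (simp add: field_simps)
qed

end

section \<open>A Ricci tensor of pure radiation form in one chart\<close>

locale pure_radiation_chart = chart_metric +
  fixes l :: "real^4 \<Rightarrow> real^4" and w :: "real^4 \<Rightarrow> real" and \<Lambda> :: real
  assumes smooth_l: "smooth_on U (\<lambda>y. l y $ a)"
    and smooth_w: "smooth_on U w"
    and null_l: "x \<in> U \<Longrightarrow> sprod (G x) (l x) (l x) = 0"
    and w_nonzero: "x \<in> U \<Longrightarrow> w x \<noteq> 0"
    and ricci_eq: "x \<in> U \<Longrightarrow> ricci G a b x = \<Lambda> * G x $ a $ b + w x * lower G l a x * lower G l b x"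
begin

abbreviation "L \<equiv> lower G l"

text \<open>The scalar is absorbed into one factor, so that derivatives of \<open>S\<close> follow
  from the Leibniz rule for a product of two covectors.\<close>

definition "W a y = w y * L a y"
definition "S a b y = W a y * L b y"

abbreviation "DL \<equiv> cov_deriv G (ctensor1 L)"
abbreviation "DW \<equiv> cov_deriv G (ctensor1 W)"
abbreviation "DS \<equiv> cov_deriv G (ctensor2 S)"

lemma smooth_L: "smooth_on U (L a)"
  unfolding lower_def by (intro smooth_intros open_U smooth_G smooth_l)

lemma smooth_W: "smooth_on U (W a)"
  unfolding W_def by (intro smooth_intros open_U smooth_w smooth_L)

lemma smooth_S: "smooth_on U (S a b)"
  unfolding S_def by (intro smooth_intros open_U smooth_W smooth_L)

lemma raise_L: "x \<in> U \<Longrightarrow> (\<Sum>b\<in>UNIV. h a b x * L b x) = l x $ a"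
  by (simp add: lower_def raise_lower)

lemma raise_W: "x \<in> U \<Longrightarrow> (\<Sum>b\<in>UNIV. h a b x * W b x) = w x * l x $ a"
  by (simp add: W_def raise_L mult.left_commute flip: sum_distrib_left)

lemma L_l: "x \<in> U \<Longrightarrow> (\<Sum>a\<in>UNIV. L a x * l x $ a) = 0"
  using null_l[of x] by (simp add: sprod_def lower_def sum_distrib_left sum_distrib_right mult_ac)

text \<open>The radiation term has no trace because \<open>l\<close> is null.\<close>

lemma scalar_curv_eq: "x \<in> U \<Longrightarrow> scalar_curv G x = 4 * \<Lambda>"
proof -
  assume x: "x \<in> U"
  have "scalar_curv G x = \<Lambda> * (\<Sum>a\<in>UNIV. \<Sum>b\<in>UNIV. h a b x * G x $ a $ b)
      + w x * (\<Sum>a\<in>UNIV. L a x * (\<Sum>b\<in>UNIV. h a b x * L b x))"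
    by (simp add: scalar_curv_def ricci_eq[OF x] distrib_left sum.distrib sum_distrib_left mult_ac)
  then show ?thesis by (simp add: trace_metric[OF x] raise_L[OF x] L_l[OF x])
qed

lemma cov_deriv_ricci: "x \<in> U \<Longrightarrow> cov_deriv G (ctensor2 (ricci G)) [e, a, b] x = DS [e, a, b] x"
proof -
  assume x: "x \<in> U"
  have "cov_deriv G (ctensor2 (ricci G)) [e, a, b] x
      = cov_deriv G (\<lambda>js y. \<Lambda> * ctensor2 (\<lambda>a b y. G y $ a $ b) js y + ctensor2 S js y) [e, a, b] x"
    by (rule cov_deriv_cong[OF x]) (auto simp: ctensor2_def S_def W_def ricci_eq split: list.split)
  also have "\<dots> = \<Lambda> * cov_deriv G (ctensor2 (\<lambda>a b y. G y $ a $ b)) [e, a, b] x + DS [e, a, b] x"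
    by (simp only: cov_deriv_add[OF x] cov_deriv_cmult[OF x] smooth_on_mult[OF open_U] smooth_on_const
        smooth_ctensor2 smooth_G smooth_S)
  finally show ?thesis by (simp add: cov_deriv_metric[OF x])
qed

lemma DS_sym: "x \<in> U \<Longrightarrow> DS [e, a, b] x = DS [e, b, a] x"
  using cov_deriv_ricci_sym[of x e a b] by (simp add: cov_deriv_ricci)

lemma div_S: "x \<in> U \<Longrightarrow> (\<Sum>a\<in>UNIV. \<Sum>b\<in>UNIV. h a b x * DS [a, b, c] x) = 0"
proof -
  assume x: "x \<in> U"
  have "pdiff c (scalar_curv G) x = pdiff c (\<lambda>y. 4 * \<Lambda>) x"
    by (rule pdiff_cong[OF open_U x]) (rule scalar_curv_eq)
  then show ?thesis using div_ricci[OF x, of c] by (simp add: cov_deriv_ricci[OF x])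
qed

lemma DS_eq: "x \<in> U \<Longrightarrow> DS [e, a, b] x = DW [e, a] x * L b x + W a x * DL [e, b] x"
proof -
  assume x: "x \<in> U"
  have p: "pdiff e (S a b) x = pdiff e (W a) x * L b x + W a x * pdiff e (L b) x"
    unfolding S_def by (rule pdiff_mult) (rule smooth_on_differentiable[OF _ x], rule smooth_W smooth_L)+
  show ?thesis
    unfolding cov_deriv_1 cov_deriv_2 ctensor_simps p
    by (simp add: S_def algebra_simps sum_distrib_left sum_distrib_right)
qed

lemma DW_eq: "x \<in> U \<Longrightarrow> DW [e, a] x = pdiff e w x * L a x + w x * DL [e, a] x"
proof -
  assume x: "x \<in> U"
  have p: "pdiff e (W a) x = pdiff e w x * L a x + w x * pdiff e (L a) x"
    unfolding W_def by (rule pdiff_mult) (rule smooth_on_differentiable[OF _ x], rule smooth_w smooth_L)+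
  show ?thesis
    unfolding cov_deriv_1 ctensor_simps p
    by (simp add: W_def algebra_simps sum_distrib_left)
qed

lemma geodetic_l:
  assumes x: "x \<in> U"
  shows "\<exists>\<kappa>. \<forall>a. (\<Sum>b\<in>UNIV. l x $ b * DL [b, a] x) = \<kappa> * L a x"
proof -
  \<comment> \<open>\<delta> is the divergence of \<open>w\<close> times \<open>l\<close>. By the
    Leibniz rule div S is \<delta> \<open>L\<close> plus \<open>w\<close> times the derivative of
    \<open>L\<close> along \<open>l\<close>.\<close>
  define \<delta> where "\<delta> = (\<Sum>a\<in>UNIV. \<Sum>b\<in>UNIV. h a b x * DW [a, b] x)"
  have "\<delta> * L c x + w x * (\<Sum>b\<in>UNIV. l x $ b * DL [b, c] x) = 0" for c
  proof -
    have "(\<Sum>a\<in>UNIV. \<Sum>b\<in>UNIV. h a b x * (W b x * DL [a, c] x))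
        = (\<Sum>a\<in>UNIV. (\<Sum>b\<in>UNIV. h a b x * W b x) * DL [a, c] x)"
      by (simp add: sum_distrib_right mult.assoc)
    also have "\<dots> = w x * (\<Sum>b\<in>UNIV. l x $ b * DL [b, c] x)"
      by (simp add: raise_W[OF x] sum_distrib_left mult.assoc)
    finally show ?thesis
      using div_S[OF x, of c]
      by (simp add: DS_eq[OF x] \<delta>_def distrib_left sum.distrib sum_distrib_right mult.assoc)
  qed
  then have "(\<Sum>b\<in>UNIV. l x $ b * DL [b, c] x) = (- \<delta> / w x) * L c x" for c
    using w_nonzero[OF x] by (simp add: field_simps eq_neg_iff_add_eq_0)
  then show ?thesis by blast
qed

section \<open>Divergence of the Weyl tensor and second derivatives of S\<close>

lemma cov_deriv_weyl:
  assumes x: "x \<in> U"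
  shows "cov_deriv G (ctensor4 (weyl G)) [f, a, b, c, d] x
      = cov_deriv G (ctensor4 (riemann G)) [f, a, b, c, d] x
    - 1/2 * (G x $ a $ c * DS [f, b, d] x - G x $ a $ d * DS [f, b, c] x
             + DS [f, a, c] x * G x $ b $ d - DS [f, a, d] x * G x $ b $ c)"
proof -
  let ?g = "\<lambda>a b y. G y $ a $ b" and ?r = "ricci G"
  let ?p = "\<lambda>P Q. ctensor4 (\<lambda>a b c d y. P a c y * Q b d y)" and ?q
      = "\<lambda>P Q. ctensor4 (\<lambda>a b c d y. P a d y * Q b c y)"
  \<comment> \<open>The factor 2 \<Lambda> / 3 is one sixth of the constant scalar curvature 4
    \<Lambda>; the terms quadratic in the metric are then parallel and drop out.\<close>
  have "cov_deriv G (ctensor4 (weyl G)) [f, a, b, c, d] x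
      = cov_deriv G (\<lambda>js y. ctensor4 (riemann G) js y + ((-1/2) * ?p ?g ?r js y + (1/2 * ?q ?g ?r js y
          + ((-1/2) * ?p ?r ?g js y + (1/2 * ?q ?r ?g js y + (2 * \<Lambda> / 3 * ?p ?g ?g js y
              + (- 2 * \<Lambda> / 3) * ?q ?g ?g js y)))))) [f, a, b, c, d] x"
    by (rule cov_deriv_cong[OF x])
      (auto simp: ctensor4_def weyl_def scalar_curv_eq algebra_simps split: list.split)
  also have "\<dots> = cov_deriv G (ctensor4 (riemann G)) [f, a, b, c, d] x
      + ((-1/2) * cov_deriv G (?p ?g ?r) [f, a, b, c, d] x + (1/2 * cov_deriv G (?q ?g ?r) [f, a, b, c, d] x
          + ((-1/2) * cov_deriv G (?p ?r ?g) [f, a, b, c, d] x + (1/2 * cov_deriv G (?q ?r ?g) [f, a, b, c, d] x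
           + (2 * \<Lambda> / 3 * cov_deriv G (?p ?g ?g) [f, a, b, c, d] x
               + (- 2 * \<Lambda> / 3) * cov_deriv G (?q ?g ?g) [f, a, b, c, d] x)))))"
    by (simp only: cov_deriv_add[OF x] cov_deriv_cmult[OF x] smooth_on_add[OF open_U] smooth_on_mult[OF open_U] smooth_on_const
        smooth_ctensor4 smooth_G smooth_ricci smooth_riemann)
  finally show ?thesis
    unfolding cov_deriv_prod_13_24[OF x smooth_G smooth_ricci] cov_deriv_prod_14_23[OF x smooth_G smooth_ricci]
      cov_deriv_prod_13_24[OF x smooth_ricci smooth_G] cov_deriv_prod_14_23[OF x smooth_ricci smooth_G]
      cov_deriv_prod_13_24[OF x smooth_G smooth_G] cov_deriv_prod_14_23[OF x smooth_G smooth_G]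
      cov_deriv_metric[OF x] cov_deriv_ricci[OF x]
    by (simp add: algebra_simps)
qed

text \<open>The Riemann tensor contributes twice the right side. Of the four metric terms two
  contain div S = 0 and the other two subtract one half.\<close>

lemma div_weyl:
  assumes x: "x \<in> U"
  shows "contr (cov_deriv G (ctensor4 (weyl G))) [a, c, b] x = 1/2 * (DS [c, a, b] x - DS [a, c, b] x)"
proof -
  have 1: "(\<Sum>f\<in>UNIV. \<Sum>d\<in>UNIV. h f d x * (k * DS [f, c, d] x)) = 0" for k c
    using div_S[OF x, of c] DS_sym[OF x, of _ c] by (simp add: mult.left_commute flip: sum_distrib_left)
  have 2: "(\<Sum>f\<in>UNIV. \<Sum>d\<in>UNIV. h f d x * (DS [f, a, d] x * k)) = 0" for k a
    using 1[of k a] by (simp add: mult.commute)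
  have 3: "(\<Sum>f\<in>UNIV. \<Sum>d\<in>UNIV. h f d x * (DS [f, a, b] x * G x $ c $ d)) = DS [c, a, b] x" for a b c
    using contract_G[OF x, of c "\<lambda>f. DS [f, a, b] x"] by (simp add: mult.commute)
  have "contr (cov_deriv G (ctensor4 (weyl G))) [a, c, b] x
      = contr (cov_deriv G (ctensor4 (riemann G))) [a, c, b] x
    - 1/2 * ((\<Sum>f\<in>UNIV. \<Sum>d\<in>UNIV. h f d x * (G x $ a $ b * DS [f, c, d] x))
           - (\<Sum>f\<in>UNIV. \<Sum>d\<in>UNIV. h f d x * (G x $ a $ d * DS [f, c, b] x))
           + (\<Sum>f\<in>UNIV. \<Sum>d\<in>UNIV. h f d x * (DS [f, a, b] x * G x $ c $ d))
           - (\<Sum>f\<in>UNIV. \<Sum>d\<in>UNIV. h f d x * (DS [f, a, d] x * G x $ c $ b)))"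
    by (simp add: contr_def cov_deriv_weyl[OF x] right_diff_distrib distrib_left sum.distrib
        sum_subtractf sum_distrib_left
        mult.left_commute[of _ "1/2"])
  then show ?thesis
    unfolding 1 2 3 contract_G[OF x] div_riemann[OF x] cov_deriv_ricci[OF x] DS_sym[OF x, of c b a] DS_sym[OF x, of a b c]
    by (simp add: field_simps)
qed

text \<open>The four terms are kept apart because contraction with a vector orthogonal to
  \<open>l\<close> kills those with an undifferentiated \<open>L\<close> or
  \<open>W\<close>.\<close>

lemma DDS_eq:
  assumes x: "x \<in> U"
  shows "cov_deriv G DS [e, c, a, b] x = cov_deriv G DW [e, c, a] x * L b x + DW [c, a] x * DL [e, b] x
     + DW [e, a] x * DL [c, b] x + W a x * cov_deriv G DL [e, c, b] x"
proof -
  have D: "L b differentiable (at x)" "W a differentiable (at x)" "DL [c, b] differentiable (at x)" "DW [c, a] differentiable (at x)"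
    using smooth_on_differentiable[OF _ x] smooth_L smooth_W smooth_cov_deriv smooth_ctensor1 by simp_all
  have "pdiff e (DS [c, a, b]) x = pdiff e (\<lambda>y. DW [c, a] y * L b y + W a y * DL [c, b] y) x"
    by (rule pdiff_cong[OF open_U x]) (rule DS_eq)
  also have "\<dots> = pdiff e (DW [c, a]) x * L b x + DW [c, a] x * pdiff e (L b) x
       + (pdiff e (W a) x * DL [c, b] x + W a x * pdiff e (DL [c, b]) x)"
    by (simp add: pdiff_add pdiff_mult D)
  finally have 1: "pdiff e (DS [c, a, b]) x = pdiff e (DW [c, a]) x * L b x + DW [c, a] x * pdiff e (L b) x
       + (pdiff e (W a) x * DL [c, b] x + W a x * pdiff e (DL [c, b]) x)" .
  show ?thesis
    unfolding cov_deriv_3 1 DS_eq[OF x] cov_deriv_2[of DW] cov_deriv_2[of DL]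
      cov_deriv_1[of _ e]
    by (simp add: algebra_simps sum.distrib sum_distrib_left sum_distrib_right)
qed

lemma cov_deriv_div_weyl:
  assumes x: "x \<in> U"
  shows "cov_deriv G (contr (cov_deriv G (ctensor4 (weyl G)))) [e, a, c, b] x
    = 1/2 * (cov_deriv G DS [e, c, a, b] x - cov_deriv G DS [e, a, c, b] x)"
proof -
  have D: "DS [c, a, b] differentiable (at x)" for a b c
    by (rule smooth_on_differentiable[OF smooth_cov_deriv x]) (rule smooth_ctensor2, rule smooth_S)
  have "pdiff e (contr (cov_deriv G (ctensor4 (weyl G))) [a, c, b]) x = pdiff e (\<lambda>y. 1/2 * (DS [c, a, b] y
      - DS [a, c, b] y)) x"
    by (rule pdiff_cong[OF open_U x]) (rule div_weyl)
  also have "\<dots> = 1/2 * (pdiff e (DS [c, a, b]) x - pdiff e (DS [a, c, b]) x)"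
    using D by (simp only: pdiff_cmult pdiff_diff differentiable_diff)
  finally show ?thesis
    unfolding cov_deriv_3 by (simp only: div_weyl[OF x])
      (simp add: algebra_simps sum_subtractf sum_distrib_left flip: sum_divide_distrib)
qed

text \<open>The derivative of div S = 0. Subtracting this zero in \<open>mixed_mm\<close> turns a
  second derivative into a commutator.\<close>

lemma contr_DDS:
  assumes x: "x \<in> U"
  shows "(\<Sum>c\<in>UNIV. \<Sum>e\<in>UNIV. h c e x * cov_deriv G DS [a, e, c, b] x) = 0"
proof -
  have S: "smooth_on U (DS js)" if "length js = 3" for js
    using that smooth_cov_deriv[of "tl js" "ctensor2 S" "hd js"] smooth_ctensor2[of U S js] smooth_S smooth_ctensor2
    by (cases js) auto
  have 0: "contr DS [b] y = 0" if "y \<in> U" for b y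
    using div_S[OF that, of b] by (simp add: contr_def DS_sym[OF that, of _ b])
  have "pdiff a (contr DS [b]) x = pdiff a (\<lambda>y. 0) x"
    by (rule pdiff_cong[OF open_U x]) (rule 0)
  then have "cov_deriv G (contr DS) [a, b] x = 0"
    by (simp add: cov_deriv_1 0[OF x])
  moreover have "cov_deriv G (contr DS) [a, b] x = (\<Sum>f\<in>UNIV. \<Sum>d\<in>UNIV. h f d x * cov_deriv G DS [a, f, b, d] x)"
    by (subst cov_deriv_contr[OF x]) (simp_all add: S)
  moreover have "cov_deriv G DS [a, f, b, d] x = cov_deriv G DS [a, f, d, b] x" for f d
  proof -
    have "pdiff a (DS [f, b, d]) x = pdiff a (DS [f, d, b]) x"
      by (rule pdiff_cong[OF open_U x]) (rule DS_sym)
    then show ?thesis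
      by (simp add: cov_deriv_3 DS_sym[OF x, of _ _ d] DS_sym[OF x, of _ b])
  qed
  ultimately show ?thesis
    by (subst sum.swap) (simp add: h_sym[OF x])
qed

end

section \<open>The Bach tensor and the optical matrix\<close>

lemma sum_reorder:
  "(\<Sum>a\<in>A. \<Sum>b\<in>B. \<Sum>c\<in>C. \<Sum>d\<in>D. F a b c d) = (\<Sum>c\<in>C. \<Sum>a\<in>A. \<Sum>d\<in>D. \<Sum>b\<in>B. F a b c d)"
  by (rule trans[OF sum_swap_pairs], rule sum.cong[OF refl], rule sum.swap)

section \<open>Null frames and the inverse metric\<close>

lemma UNIV_4_from_0: "UNIV = {0, 1, 2, 3 :: 4}"
proof -
  \<comment> \<open>In the type \<open>4\<close> the numeral 4 denotes 0, while frames are indexed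
    from 0.\<close>
  have 4: "(4 :: 4) = 0" by simp
  show ?thesis unfolding UNIV_4 4 by (rule set_eqI) (simp only: insert_iff empty_iff, blast)
qed

lemma sum_4_from_0: "sum f (UNIV :: 4 set) = f 0 + f 1 + f 2 + f 3"
  unfolding UNIV_4_from_0 by (simp add: add.assoc)

lemma sprod_sym: "(\<And>a b. M $ a $ b = M $ b $ a) \<Longrightarrow> sprod M u v = sprod M v u"
  unfolding sprod_def by (subst sum.swap) (simp add: mult_ac)

text \<open>Completeness relation of the frame. The rows of \<open>F\<close> are dual to the columns
  of \<open>E\<close>, so \<open>F ** M ** E\<close> is the identity, and for square matrices a
  one-sided inverse is two-sided.\<close>

lemma null_frame_inverse:
  assumes sym: "\<And>a b. M $ a $ b = M $ b $ a" and e: "null_frame M e"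
  shows "matrix_inv M $ a $ b = e 0 $ a * e 1 $ b + e 1 $ a * e 0 $ b + e 2 $ a * e 2 $ b + e 3 $ a * e 3 $ b"
proof -
  \<comment> \<open>Duality exchanges the two null vectors and fixes the spacelike ones.\<close>
  define \<sigma> :: "4 \<Rightarrow> 4" where "\<sigma> i = (if i = 0 then 1 else if i = 1 then 0 else i)" for i
  define E :: "real^4^4" where "E = (\<chi> a i. e i $ a)"
  define F :: "real^4^4" where "F = (\<chi> i a. e (\<sigma> i) $ a)"
  have \<eta>: "sprod M (e i) (e j) = (if i = \<sigma> j then 1 else 0)" for i j
  proof -
    have "i = 0 \<or> i = 1 \<or> i = 2 \<or> i = 3" "j = 0 \<or> j = 1 \<or> j = 2 \<or> j = 3" using UNIV_4_from_0 by auto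
    moreover have "sprod M (e 0) (e 0) = 0" "sprod M (e 1) (e 1) = 0" "sprod M (e 0) (e 1) = 1"
      "sprod M (e 0) (e 2) = 0" "sprod M (e 0) (e 3) = 0" "sprod M (e 1) (e 2) = 0" "sprod M (e 1) (e 3) = 0"
      "sprod M (e 2) (e 2) = 1" "sprod M (e 3) (e 3) = 1" "sprod M (e 2) (e 3) = 0" "sprod M (e 3) (e 2) = 0"
      using e unfolding null_frame_def by auto
    moreover have "sprod M (e 1) (e 0) = sprod M (e 0) (e 1)" "sprod M (e 2) (e 0) = sprod M (e 0) (e 2)"
      "sprod M (e 3) (e 0) = sprod M (e 0) (e 3)" "sprod M (e 2) (e 1) = sprod M (e 1) (e 2)"
      "sprod M (e 3) (e 1) = sprod M (e 1) (e 3)"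
      by (rule sprod_sym[OF sym])+
    ultimately show ?thesis by (elim disjE) (simp_all add: \<sigma>_def)
  qed
  have "(F ** M ** E) $ i $ j = sprod M (e (\<sigma> i)) (e j)" for i j
    unfolding sprod_def by (subst sum.swap) (simp add: matrix_matrix_mult_def F_def E_def sum_distrib_left sum_distrib_right mult_ac)
  moreover have "\<sigma> i = \<sigma> j \<longleftrightarrow> i = j" for i j
    by (auto simp: \<sigma>_def split: if_splits)
  ultimately have "(F ** M) ** E = mat 1"
    by (simp add: vec_eq_iff mat_def \<eta>)
  then have "E ** (F ** M) = mat 1" by (rule iffD1[OF matrix_left_right_inverse])
  then have 1: "(E ** F) ** M = mat 1" by (simp add: matrix_mul_assoc)
  then have "invertible M" by (simp add: invertible_left_inverse) blast
  then have "matrix_inv M = E ** F"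
    using 1 matrix_mul_assoc[of "E ** F" M "matrix_inv M"] by (simp add: matrix_inv_right)
  then show ?thesis
    by (simp add: matrix_matrix_mult_def E_def F_def sum_4_from_0 \<sigma>_def)
qed

section \<open>Reduced field equations and the Bach tensor\<close>

context pure_radiation_chart
begin

lemma hessian_scalar_curv: "x \<in> U \<Longrightarrow> hessian G (scalar_curv G) a b x = 0"
proof -
  assume x: "x \<in> U"
  have 0: "cov_deriv G (ctensor0 (scalar_curv G)) [a] y = 0" if "y \<in> U" for a y
  proof -
    have "pdiff a (scalar_curv G) y = pdiff a (\<lambda>y. 4 * \<Lambda>) y"
      by (rule pdiff_cong[OF open_U that]) (rule scalar_curv_eq)
    then show ?thesis by (simp add: cov_deriv_0)
  qed
  have "pdiff a (cov_deriv G (ctensor0 (scalar_curv G)) [b]) x = pdiff a (\<lambda>y. 0) x"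
    by (rule pdiff_cong[OF open_U x]) (rule 0)
  then show ?thesis by (simp add: hessian_def cov_deriv_1 0[OF x])
qed

text \<open>With scalar curvature 4 \<Lambda> the bracket of \<gamma> is S, while the bracket of 2
  \<beta> is 4 \<Lambda> (\<Lambda> g + S) - 4 \<Lambda>^2 g = 4 \<Lambda> S.\<close>

lemma field_equation:
  assumes x: "x \<in> U"
    and eq: "\<gamma> * (ricci G a b x - 1/2 * scalar_curv G x * G x $ a $ b + \<Lambda> * G x $ a $ b)
        - 4 * \<alpha> * bach G a b x
        + 2 * \<beta> * (ricci G a b x * scalar_curv G x
                   - 1/4 * scalar_curv G x * G x $ a $ b * scalar_curv G x
                   + G x $ a $ b * dalembertian G (scalar_curv G) x
                   - hessian G (scalar_curv G) b a x) = 0"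
  shows "4 * \<alpha> * bach G a b x = (\<gamma> + 8 * \<beta> * \<Lambda>) * S a b x"
  using eq by (simp add: dalembertian_def hessian_scalar_curv[OF x] scalar_curv_eq[OF x] ricci_eq[OF x] S_def W_def
      algebra_simps)

lemma ricci_raise:
  assumes x: "x \<in> U"
  shows "(\<Sum>e\<in>UNIV. \<Sum>f\<in>UNIV. h c e x * (h d f x * ricci G e f x)) = \<Lambda> * h c d x + w x * (l x $ c * l x $ d)"
proof -
  have "(\<Sum>f\<in>UNIV. h d f x * ricci G e f x) = \<Lambda> * (\<Sum>f\<in>UNIV. h d f x * G x $ f $ e)
      + w x * (L e x * (\<Sum>f\<in>UNIV. h d f x * L f x))" for e
    by (simp add: ricci_eq[OF x] G_sym[OF x, of e] distrib_left sum.distrib sum_distrib_left mult_ac)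
  then have 1: "(\<Sum>f\<in>UNIV. h d f x * ricci G e f x) = (if e = d then \<Lambda> else 0) + w x * l x $ d * L e x" for e
    by (auto simp: h_G[OF x] raise_L[OF x])
  have "(\<Sum>e\<in>UNIV. \<Sum>f\<in>UNIV. h c e x * (h d f x * ricci G e f x))
      = (\<Sum>e\<in>UNIV. h c e x * (\<Sum>f\<in>UNIV. h d f x * ricci G e f x))"
    by (simp add: sum_distrib_left)
  also have "\<dots> = (\<Sum>e\<in>UNIV. if e = d then h c e x * \<Lambda> else 0) + w x * l x $ d * (\<Sum>e\<in>UNIV. h c e x * L e x)"
    unfolding 1 sum_distrib_left sum.distrib[symmetric] by (rule sum.cong) (auto simp: algebra_simps)
  finally show ?thesis by (simp add: raise_L[OF x] mult_ac)
qed

text \<open>The first two terms come from \<open>div_weyl\<close>. In the Ricci term only the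
  radiation part survives, since the Weyl tensor is traceless.\<close>

lemma bach_eq:
  assumes x: "x \<in> U"
  shows "bach G a b x = 1/2 * (\<Sum>c\<in>UNIV. \<Sum>e\<in>UNIV. h c e x * cov_deriv G DS [e, c, a, b] x)
    - 1/2 * (\<Sum>c\<in>UNIV. \<Sum>e\<in>UNIV. h c e x * cov_deriv G DS [e, a, c, b] x)
    + 1/2 * (w x * (\<Sum>c\<in>UNIV. \<Sum>d\<in>UNIV. l x $ c * l x $ d * weyl G a c b d x))"
proof -
  let ?D = "cov_deriv G (cov_deriv G (ctensor4 (weyl G)))"
  have C: "smooth_on U (cov_deriv G (ctensor4 (weyl G)) js)" if "length js = 5" for js
    using that smooth_cov_deriv[of "tl js" "ctensor4 (weyl G)" "hd js"] smooth_ctensor4[OF smooth_weyl]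
    by (cases js) auto
  have 1: "(\<Sum>c\<in>UNIV. \<Sum>d\<in>UNIV. \<Sum>e\<in>UNIV. \<Sum>f\<in>UNIV. h c e x * h d f x * ?D [e, f, a, c, b, d] x)
      = (\<Sum>c\<in>UNIV. \<Sum>e\<in>UNIV. h c e x * (1/2 * (cov_deriv G DS [e, c, a, b] x - cov_deriv G DS [e, a, c, b] x)))"
  proof (rule sum.cong[OF refl])
    fix c
    have "(\<Sum>d\<in>UNIV. \<Sum>e\<in>UNIV. \<Sum>f\<in>UNIV. h c e x * h d f x * ?D [e, f, a, c, b, d] x)
        = (\<Sum>e\<in>UNIV. \<Sum>d\<in>UNIV. \<Sum>f\<in>UNIV. h c e x * h d f x * ?D [e, f, a, c, b, d] x)"
      by (rule sum.swap)
    also have "\<dots> = (\<Sum>e\<in>UNIV. \<Sum>f\<in>UNIV. \<Sum>d\<in>UNIV. h c e x * h d f x * ?D [e, f, a, c, b, d] x)"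
      by (rule sum.cong[OF refl], rule sum.swap)
    also have "\<dots> = (\<Sum>e\<in>UNIV. h c e x * cov_deriv G (contr (cov_deriv G (ctensor4 (weyl G)))) [e, a, c, b] x)"
      by (subst cov_deriv_contr[OF x]) (simp_all add: C sum_distrib_left h_sym[OF x] mult_ac)
    finally show "(\<Sum>d\<in>UNIV. \<Sum>e\<in>UNIV. \<Sum>f\<in>UNIV. h c e x * h d f x * ?D [e, f, a, c, b, d] x)
        = (\<Sum>e\<in>UNIV. h c e x * (1/2 * (cov_deriv G DS [e, c, a, b] x - cov_deriv G DS [e, a, c, b] x)))"
      by (simp only: cov_deriv_div_weyl[OF x])
  qed
  have "(\<Sum>c\<in>UNIV. \<Sum>d\<in>UNIV. \<Sum>e\<in>UNIV. \<Sum>f\<in>UNIV. h c e x * h d f x * (1/2 * ricci G e f x * weyl G a c b d x))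
     = 1/2 * (\<Sum>c\<in>UNIV. \<Sum>d\<in>UNIV. (\<Sum>e\<in>UNIV. \<Sum>f\<in>UNIV. h c e x * (h d f x * ricci G e f x)) * weyl G a c b d x)"
    by (simp only: sum_distrib_left sum_distrib_right) (simp add: mult_ac)
  also have "\<dots> = 1/2 * (\<Lambda> * (\<Sum>c\<in>UNIV. \<Sum>d\<in>UNIV. h c d x * weyl G a c b d x)
      + w x * (\<Sum>c\<in>UNIV. \<Sum>d\<in>UNIV. l x $ c * l x $ d * weyl G a c b d x))"
    unfolding ricci_raise[OF x] by (simp only: distrib_right sum.distrib sum_distrib_left mult.assoc)
  finally have 2: "(\<Sum>c\<in>UNIV. \<Sum>d\<in>UNIV. \<Sum>e\<in>UNIV. \<Sum>f\<in>UNIV. h c e x * h d f x * (1/2 * ricci G e f x * weyl G a c b d x))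
     = 1/2 * (w x * (\<Sum>c\<in>UNIV. \<Sum>d\<in>UNIV. l x $ c * l x $ d * weyl G a c b d x))"
    by (simp add: weyl_trace[OF x])
  show ?thesis
    unfolding bach_def distrib_left sum.distrib 1 2
    by (simp add: right_diff_distrib sum_subtractf sum_distrib_left mult.left_commute[of _ "1/2"])
qed

text \<open>Here \<open>m\<close> is a vector at the single point \<open>x\<close>: identities are
  contracted with it only after all derivatives are taken. The last assumption is C(l, m, l, m) =
  0.\<close>

context
  fixes x and m :: "real^4"
  assumes x: "x \<in> U" and Lm: "(\<Sum>a\<in>UNIV. L a x * m $ a) = 0"
    and aligned: "(\<Sum>a\<in>UNIV. \<Sum>b\<in>UNIV. \<Sum>c\<in>UNIV. \<Sum>d\<in>UNIV.
      l x $ a * m $ b * l x $ c * m $ d * weyl G a b c d x) = 0"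
begin

lemma mL: "(\<Sum>a\<in>UNIV. m $ a * L a x) = 0"
  using Lm by (simp add: mult.commute)

text \<open>Every product by which Riemann differs from Weyl has a factor g or Ric evaluated on (l,
  l), (l, m) or (m, l), and all of these vanish.\<close>

lemma riemann_lmlm:
  "(\<Sum>a\<in>UNIV. \<Sum>b\<in>UNIV. \<Sum>c\<in>UNIV. \<Sum>d\<in>UNIV. l x $ a * m $ b * l x $ c * m $ d * riemann G a b c d x) = 0"
proof -
  let ?s = "\<lambda>F. \<Sum>a\<in>UNIV. \<Sum>b\<in>UNIV. \<Sum>c\<in>UNIV. \<Sum>d\<in>UNIV. l x $ a * m $ b * l x $ c * m $ d * F a b c d"
  let ?G = "\<lambda>a b. G x $ a $ b" and ?R = "\<lambda>a b. ricci G a b x"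
  have ll: "(\<Sum>a\<in>UNIV. \<Sum>b\<in>UNIV. ?G a b * l x $ a * l x $ b) = 0"
    using null_l[OF x] by (simp add: sprod_def)
  have ml: "(\<Sum>a\<in>UNIV. \<Sum>b\<in>UNIV. ?G a b * m $ a * l x $ b) = 0"
    using Lm by (simp add: lower_def sum_distrib_left sum_distrib_right mult_ac)
  have lm: "(\<Sum>a\<in>UNIV. \<Sum>b\<in>UNIV. ?G a b * l x $ a * m $ b) = 0"
    using ml by (subst sum.swap) (simp add: G_sym[OF x] mult_ac)
  have Rll: "(\<Sum>a\<in>UNIV. \<Sum>b\<in>UNIV. ?R a b * l x $ a * l x $ b) = 0"
  proof -
    have "(\<Sum>a\<in>UNIV. \<Sum>b\<in>UNIV. ?R a b * l x $ a * l x $ b)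
      = \<Lambda> * (\<Sum>a\<in>UNIV. \<Sum>b\<in>UNIV. ?G a b * l x $ a * l x $ b)
          + w x * ((\<Sum>a\<in>UNIV. L a x * l x $ a) * (\<Sum>b\<in>UNIV. L b x * l x $ b))"
      by (simp add: ricci_eq[OF x] sum_product distrib_left distrib_right sum.distrib sum_distrib_left mult_ac)
    then show ?thesis by (simp add: ll L_l[OF x])
  qed
  have Rlm: "(\<Sum>a\<in>UNIV. \<Sum>b\<in>UNIV. ?R a b * l x $ a * m $ b) = 0"
  proof -
    have "(\<Sum>a\<in>UNIV. \<Sum>b\<in>UNIV. ?R a b * l x $ a * m $ b)
      = \<Lambda> * (\<Sum>a\<in>UNIV. \<Sum>b\<in>UNIV. ?G a b * l x $ a * m $ b)
          + w x * ((\<Sum>a\<in>UNIV. L a x * l x $ a) * (\<Sum>b\<in>UNIV. L b x * m $ b))"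
      by (simp add: ricci_eq[OF x] sum_product distrib_left distrib_right sum.distrib sum_distrib_left mult_ac)
    then show ?thesis by (simp add: lm L_l[OF x])
  qed
  have "?s (\<lambda>a b c d. riemann G a b c d x) = ?s (\<lambda>a b c d. weyl G a b c d x)
      + 1/2 * ?s (\<lambda>a b c d. ?G a c * ?R b d) - 1/2 * ?s (\<lambda>a b c d. ?G a d * ?R b c)
      + 1/2 * ?s (\<lambda>a b c d. ?R a c * ?G b d) - 1/2 * ?s (\<lambda>a b c d. ?R a d * ?G b c)
      - 1/6 * scalar_curv G x * ?s (\<lambda>a b c d. ?G a c * ?G b d)
      + 1/6 * scalar_curv G x * ?s (\<lambda>a b c d. ?G a d * ?G b c)"
    by (simp only: sum_distrib_left sum.distrib[symmetric] sum_subtractf[symmetric])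
      (simp add: weyl_def algebra_simps)
  then show ?thesis
    unfolding sum_product_13_24 sum_product_14_23 aligned ll lm Rll Rlm by simp
qed

text \<open>The gradient of \<open>w\<close> drops out because \<open>m\<close> is orthogonal to
  \<open>l\<close>.\<close>

lemma contr_DW: "(\<Sum>a\<in>UNIV. m $ a * DW [c, a] x) = w x * (\<Sum>a\<in>UNIV. m $ a * DL [c, a] x)"
proof -
  have "(\<Sum>a\<in>UNIV. m $ a * DW [c, a] x) = pdiff c w x * (\<Sum>a\<in>UNIV. m $ a * L a x)
      + w x * (\<Sum>a\<in>UNIV. m $ a * DL [c, a] x)"
    by (simp add: DW_eq[OF x] distrib_left sum.distrib sum_distrib_left mult_ac)
  then show ?thesis by (simp add: mL)
qed

lemma mW: "(\<Sum>a\<in>UNIV. m $ a * W a x) = 0"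
  using mL by (simp add: W_def mult.left_commute flip: sum_distrib_left)

text \<open>Only the two cross terms of \<open>DDS_eq\<close> survive the contraction, and they
  coincide.\<close>

lemma laplacian_mm: "(\<Sum>a\<in>UNIV. \<Sum>b\<in>UNIV. m $ a * m $ b * (\<Sum>c\<in>UNIV. \<Sum>e\<in>UNIV. h c e x * cov_deriv G DS [e, c, a, b] x))
    = 2 * w x * (\<Sum>c\<in>UNIV. \<Sum>e\<in>UNIV. h c e x * ((\<Sum>a\<in>UNIV. m $ a * DL [c, a] x) * (\<Sum>a\<in>UNIV. m $ a * DL [e, a] x)))"
proof -
  have "(\<Sum>a\<in>UNIV. \<Sum>b\<in>UNIV. m $ a * m $ b * cov_deriv G DS [e, c, a, b] x)
      = 2 * w x * ((\<Sum>a\<in>UNIV. m $ a * DL [c, a] x) * (\<Sum>a\<in>UNIV. m $ a * DL [e, a] x))" for c e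
    unfolding DDS_eq[OF x] distrib_left sum.distrib sum_sum_rank_one mL mW contr_DW by simp
  then have "(\<Sum>c\<in>UNIV. \<Sum>e\<in>UNIV. h c e x * (\<Sum>a\<in>UNIV. \<Sum>b\<in>UNIV. m $ a * m $ b * cov_deriv G DS [e, c, a, b] x))
      = 2 * w x * (\<Sum>c\<in>UNIV. \<Sum>e\<in>UNIV. h c e x * ((\<Sum>a\<in>UNIV. m $ a * DL [c, a] x) * (\<Sum>a\<in>UNIV. m $ a * DL [e, a] x)))"
    by (simp only: sum_distrib_left mult.left_commute[of _ "2 * w x"])
  moreover have "(\<Sum>a\<in>UNIV. \<Sum>b\<in>UNIV. m $ a * m $ b * (\<Sum>c\<in>UNIV. \<Sum>e\<in>UNIV. h c e x * cov_deriv G DS [e, c, a, b] x))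
     = (\<Sum>c\<in>UNIV. \<Sum>e\<in>UNIV. h c e x * (\<Sum>a\<in>UNIV. \<Sum>b\<in>UNIV. m $ a * m $ b * cov_deriv G DS [e, c, a, b] x))"
    unfolding sum_distrib_left by (subst sum_swap_pairs) (simp add: mult_ac)
  ultimately show ?thesis by simp
qed

lemma mixed_mm: "(\<Sum>a\<in>UNIV. \<Sum>b\<in>UNIV. m $ a * m $ b * (\<Sum>c\<in>UNIV. \<Sum>e\<in>UNIV. h c e x * cov_deriv G DS [e, a, c, b] x)) = 0"
proof -
  \<comment> \<open>The commutator acting on \<open>W\<close>. It comes multiplied by
    \<open>L b x\<close>, so contraction with \<open>m\<close> removes it without its being
    evaluated.\<close>
  define K where "K a = (\<Sum>c\<in>UNIV. \<Sum>e\<in>UNIV. h c e x * (cov_deriv G DW [e, a, c] x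
      - cov_deriv G DW [a, e, c] x))" for a
  have up: "(\<Sum>d\<in>UNIV. riemann_up G d b e a x * L d x) = (\<Sum>d\<in>UNIV. l x $ d * riemann G d b e a x)" for a b e
  proof -
    have "(\<Sum>d\<in>UNIV. riemann_up G d b e a x * L d x)
        = (\<Sum>d\<in>UNIV. \<Sum>k\<in>UNIV. G x $ k $ d * (riemann_up G d b e a x * l x $ k))"
      unfolding lower_def sum_distrib_left using G_sym[OF x] by (intro sum.cong refl) (metis mult.left_commute)
    also have "\<dots> = (\<Sum>k\<in>UNIV. \<Sum>d\<in>UNIV. G x $ k $ d * (riemann_up G d b e a x * l x $ k))"
      by (rule sum.swap)
    finally show ?thesis by (simp add: riemann_def sum_distrib_left mult_ac)
  qed
  have "(\<Sum>c\<in>UNIV. \<Sum>e\<in>UNIV. h c e x * cov_deriv G DS [e, a, c, b] x)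
      = K a * L b x - w x * (\<Sum>e\<in>UNIV. \<Sum>d\<in>UNIV. l x $ e * l x $ d * riemann G d b e a x)" for a b
  proof -
    have "(\<Sum>c\<in>UNIV. \<Sum>e\<in>UNIV. h c e x * cov_deriv G DS [e, a, c, b] x)
       = (\<Sum>c\<in>UNIV. \<Sum>e\<in>UNIV. h c e x * (cov_deriv G DS [e, a, c, b] x - cov_deriv G DS [a, e, c, b] x))"
      using contr_DDS[OF x, of a b] by (simp add: right_diff_distrib sum_subtractf)
    \<comment> \<open>The cross terms of \<open>DDS_eq\<close> are symmetric under exchange of
      \<open>e\<close> and \<open>a\<close> and cancel in the commutator.\<close>
    also have "\<dots> = (\<Sum>c\<in>UNIV. \<Sum>e\<in>UNIV. h c e x * ((cov_deriv G DW [e, a, c] x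
        - cov_deriv G DW [a, e, c] x) * L b x
          + W c x * (cov_deriv G DL [e, a, b] x - cov_deriv G DL [a, e, b] x)))"
      by (simp add: DDS_eq[OF x] algebra_simps)
    also have "\<dots> = K a * L b x - (\<Sum>c\<in>UNIV. \<Sum>e\<in>UNIV. h e c x * W c x * (\<Sum>d\<in>UNIV. l x $ d * riemann G d b e a x))"
      unfolding ricci_identity[OF x smooth_L] up K_def
      by (simp add: algebra_simps sum.distrib sum_subtractf sum_distrib_left sum_distrib_right h_sym[OF x])
    also have "(\<Sum>c\<in>UNIV. \<Sum>e\<in>UNIV. h e c x * W c x * (\<Sum>d\<in>UNIV. l x $ d * riemann G d b e a x))
       = (\<Sum>e\<in>UNIV. (\<Sum>c\<in>UNIV. h e c x * W c x) * (\<Sum>d\<in>UNIV. l x $ d * riemann G d b e a x))"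
      unfolding sum_distrib_right[of _ UNIV "sum _ _"] by (rule sum.swap)
    finally show ?thesis by (simp add: raise_W[OF x] sum_distrib_left mult.assoc)
  qed
  then have "(\<Sum>a\<in>UNIV. \<Sum>b\<in>UNIV. m $ a * m $ b * (\<Sum>c\<in>UNIV. \<Sum>e\<in>UNIV. h c e x * cov_deriv G DS [e, a, c, b] x))
     = (\<Sum>a\<in>UNIV. m $ a * K a) * (\<Sum>b\<in>UNIV. m $ b * L b x)
       - w x * (\<Sum>a\<in>UNIV. \<Sum>b\<in>UNIV. \<Sum>e\<in>UNIV. \<Sum>d\<in>UNIV. l x $ e * m $ a * l x $ d * m $ b * riemann G e a d b x)"
    unfolding sum_sum_rank_one[symmetric]
    by (simp add: riemann_pair_sym[OF x, of _ _ _ _] right_diff_distrib sum_subtractf sum_distrib_left mult_ac)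
  also have "(\<Sum>a\<in>UNIV. \<Sum>b\<in>UNIV. \<Sum>e\<in>UNIV. \<Sum>d\<in>UNIV. l x $ e * m $ a * l x $ d * m $ b * riemann G e a d b x)
     = (\<Sum>e\<in>UNIV. \<Sum>a\<in>UNIV. \<Sum>d\<in>UNIV. \<Sum>b\<in>UNIV. l x $ e * m $ a * l x $ d * m $ b * riemann G e a d b x)"
    by (rule sum_reorder)
  finally show ?thesis by (simp add: mL riemann_lmlm)
qed

lemma weyl_mm: "(\<Sum>a\<in>UNIV. \<Sum>b\<in>UNIV. m $ a * m $ b * (\<Sum>c\<in>UNIV. \<Sum>d\<in>UNIV. l x $ c * l x $ d * weyl G a c b d x))
    = 0"
proof -
  have "weyl G a c b d x = weyl G c a d b x" for a b c d
    using weyl_antisym12[OF x, of a c b d] weyl_antisym34[of c a b d x] by simp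
  then have "(\<Sum>a\<in>UNIV. \<Sum>b\<in>UNIV. m $ a * m $ b * (\<Sum>c\<in>UNIV. \<Sum>d\<in>UNIV. l x $ c * l x $ d * weyl G a c b d x))
    = (\<Sum>a\<in>UNIV. \<Sum>b\<in>UNIV. \<Sum>c\<in>UNIV. \<Sum>d\<in>UNIV. l x $ c * m $ a * l x $ d * m $ b * weyl G c a d b x)"
    unfolding sum_distrib_left by (intro sum.cong refl) (simp add: mult_ac)
  also have "\<dots> = (\<Sum>c\<in>UNIV. \<Sum>a\<in>UNIV. \<Sum>d\<in>UNIV. \<Sum>b\<in>UNIV. l x $ c * m $ a * l x $ d * m $ b * weyl G c a d b x)"
    by (rule sum_reorder)
  finally show ?thesis using aligned by simp
qed

lemma bach_mm: "(\<Sum>a\<in>UNIV. \<Sum>b\<in>UNIV. m $ a * m $ b * bach G a b x)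
    = w x * (\<Sum>c\<in>UNIV. \<Sum>e\<in>UNIV. h c e x * ((\<Sum>a\<in>UNIV. m $ a * DL [c, a] x) * (\<Sum>a\<in>UNIV. m $ a * DL [e, a] x)))"
proof -
  have "(\<Sum>a\<in>UNIV. \<Sum>b\<in>UNIV. m $ a * m $ b * bach G a b x)
    = 1/2 * (\<Sum>a\<in>UNIV. \<Sum>b\<in>UNIV. m $ a * m $ b * (\<Sum>c\<in>UNIV. \<Sum>e\<in>UNIV. h c e x * cov_deriv G DS [e, c, a, b] x))
    - 1/2 * (\<Sum>a\<in>UNIV. \<Sum>b\<in>UNIV. m $ a * m $ b * (\<Sum>c\<in>UNIV. \<Sum>e\<in>UNIV. h c e x * cov_deriv G DS [e, a, c, b] x))
    + 1/2 * (w x * (\<Sum>a\<in>UNIV. \<Sum>b\<in>UNIV. m $ a * m $ b * (\<Sum>c\<in>UNIV. \<Sum>d\<in>UNIV. l x $ c * l x $ d * weyl G a c b d x)))"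
    unfolding bach_eq[OF x] distrib_left right_diff_distrib sum.distrib sum_subtractf
    by (simp add: sum_distrib_left mult_ac)
  then show ?thesis unfolding laplacian_mm mixed_mm weyl_mm by simp
qed

end

text \<open>Row \<open>i\<close> is treated with \<open>m = e i\<close>; \<open>k\<close> and
  \<open>k'\<close> stand for 4 \<alpha> and \<gamma> + 8 \<beta> \<Lambda>. The field equations
  give B(m, m) = 0 since S(m, m) = 0.\<close>

lemma optical_matrix_zero:
  assumes x: "x \<in> U" and e: "null_frame (G x) e" "e 0 = l x" and i: "i \<in> {2, 3}" and j: "j \<in> {2, 3}"
    and aligned: "(\<Sum>a\<in>UNIV. \<Sum>b\<in>UNIV. \<Sum>c\<in>UNIV. \<Sum>d\<in>UNIV.
      l x $ a * e i $ b * l x $ c * e i $ d * weyl G a b c d x) = 0"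
    and field: "\<And>a b. k * bach G a b x = k' * S a b x" and k: "k \<noteq> 0"
  shows "optical_matrix G l e i j x = 0"
proof -
  define v where "v c = (\<Sum>a\<in>UNIV. e i $ a * DL [c, a] x)" for c
  have Lm: "(\<Sum>a\<in>UNIV. L a x * e i $ a) = 0"
  proof -
    have "sprod (G x) (e i) (e 0) = 0"
      using e i sprod_sym[OF G_sym[OF x], of "e i" "e 0"] unfolding null_frame_def by auto
    then show ?thesis
      by (simp add: sprod_def lower_def e(2) sum_distrib_left sum_distrib_right mult_ac)
  qed
  note mL = mL[OF x Lm aligned]
  have "(\<Sum>a\<in>UNIV. \<Sum>b\<in>UNIV. e i $ a * e i $ b * S a b x)
      = w x * ((\<Sum>a\<in>UNIV. e i $ a * L a x) * (\<Sum>b\<in>UNIV. e i $ b * L b x))"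
    unfolding sum_sum_rank_one[symmetric] by (simp add: S_def W_def sum_distrib_left mult_ac)
  then have "k * (\<Sum>a\<in>UNIV. \<Sum>b\<in>UNIV. e i $ a * e i $ b * bach G a b x) = 0"
    by (simp add: sum_distrib_left mult.left_commute[of k] field) 
      (simp add: mult.left_commute[of _ k'] mL flip: sum_distrib_left)
  then have "(\<Sum>c\<in>UNIV. \<Sum>d\<in>UNIV. h c d x * (v c * v d)) = 0"
    using k w_nonzero[OF x] bach_mm[OF x Lm aligned] by (simp add: v_def)
  \<comment> \<open>The completeness relation leaves one product of indefinite sign, that of the
    components along \<open>e 0\<close> and \<open>e 1\<close>; its first factor vanishes next
    because \<open>l\<close> is geodetic, so both squares are zero.\<close>
  moreover have "(\<Sum>c\<in>UNIV. \<Sum>d\<in>UNIV. h c d x * (v c * v d))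
     = 2 * (\<Sum>c\<in>UNIV. e 0 $ c * v c) * (\<Sum>d\<in>UNIV. e 1 $ d * v d)
       + (\<Sum>c\<in>UNIV. e 2 $ c * v c)^2 + (\<Sum>c\<in>UNIV. e 3 $ c * v c)^2"
  proof -
    have "(\<Sum>c\<in>UNIV. \<Sum>d\<in>UNIV. h c d x * (v c * v d))
     = (\<Sum>c\<in>UNIV. e 0 $ c * v c) * (\<Sum>d\<in>UNIV. e 1 $ d * v d) + (\<Sum>c\<in>UNIV. e 1 $ c * v c) * (\<Sum>d\<in>UNIV. e 0 $ d * v d)
       + (\<Sum>c\<in>UNIV. e 2 $ c * v c) * (\<Sum>c\<in>UNIV. e 2 $ c * v c)
           + (\<Sum>c\<in>UNIV. e 3 $ c * v c) * (\<Sum>c\<in>UNIV. e 3 $ c * v c)"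
      unfolding sum_product sum.distrib[symmetric]
      by (simp add: inv_metric_def null_frame_inverse[OF G_sym[OF x] e(1)] algebra_simps)
    then show ?thesis by (simp add: power2_eq_square)
  qed
  moreover have "(\<Sum>c\<in>UNIV. e 0 $ c * v c) = 0"
  proof -
    obtain \<kappa> where \<kappa>: "\<And>a. (\<Sum>b\<in>UNIV. l x $ b * DL [b, a] x) = \<kappa> * L a x"
      using geodetic_l[OF x] by blast
    have "(\<Sum>c\<in>UNIV. e 0 $ c * v c) = (\<Sum>a\<in>UNIV. e i $ a * (\<Sum>b\<in>UNIV. l x $ b * DL [b, a] x))"
      unfolding v_def sum_distrib_left by (subst sum.swap) (simp add: e(2) mult_ac)
    also have "\<dots> = \<kappa> * (\<Sum>a\<in>UNIV. e i $ a * L a x)"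
      by (simp add: \<kappa> sum_distrib_left mult_ac)
    finally show ?thesis by (simp add: mL)
  qed
  ultimately have "(\<Sum>c\<in>UNIV. e j $ c * v c) = 0"
    using j by (auto simp: sum_power2_eq_zero_iff)
  moreover have "optical_matrix G l e i j x = (\<Sum>c\<in>UNIV. e j $ c * v c)"
    unfolding optical_matrix_def cov_deriv_lower_def v_def sum_distrib_left
    by (subst sum.swap) (simp add: mult_ac)
  ultimately show ?thesis by simp
qed

lemma L_nonzero:
  assumes "x \<in> U" "l x \<noteq> 0"
  shows "\<exists>a. L a x \<noteq> 0"
  using raise_L[OF assms(1)] assms(2)
      by (metis (no_types, lifting) mult_zero_right sum.neutral vec_eq_iff zero_index)

end

section \<open>Alignment in terms of frame components\<close>

lemma sum_lists_length_4:
  fixes F :: "'a::finite list \<Rightarrow> real"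
  shows "(\<Sum>js | length js = 4. F js) = (\<Sum>a\<in>UNIV. \<Sum>b\<in>UNIV. \<Sum>c\<in>UNIV. \<Sum>d\<in>UNIV. F [a, b, c, d])"
proof -
  have "(\<Sum>js | length js = 4. F js) = (\<Sum>(a, b, c, d)\<in>UNIV. F [a, b, c, d])"
    by (rule sum.reindex_bij_witness[of _ "\<lambda>(a, b, c, d). [a, b, c, d]" "\<lambda>js. (js ! 0, js ! 1, js ! 2, js ! 3)"])
      (auto simp: numeral_eq_Suc length_Suc_conv)
  then show ?thesis by (simp add: sum.cartesian_product UNIV_Times_UNIV)
qed

text \<open>A nonzero component C(l, m, l, m) has boost weight 2 and would push the boost order
  above 1.\<close>

lemma weyl_aligned_component:
  assumes "weyl_aligned A g l" "c \<in> A" "x \<in> chart_image c" and e: "null_frame (g c x) e" "e 0 = l c x"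
    and i: "i \<in> {2, 3}"
  shows "(\<Sum>a\<in>UNIV. \<Sum>b\<in>UNIV. \<Sum>c'\<in>UNIV. \<Sum>d\<in>UNIV.
      l c x $ a * e i $ b * l c x $ c' * e i $ d * weyl (g c) a b c' d x) = 0"
proof (rule ccontr)
  let ?T = "ctensor4 (weyl (g c))"
  have fc: "frame_comp ?T x f [0, i, 0, i] = (\<Sum>a\<in>UNIV. \<Sum>b\<in>UNIV. \<Sum>c'\<in>UNIV. \<Sum>d\<in>UNIV.
      f 0 $ a * f i $ b * f 0 $ c' * f i $ d * weyl (g c) a b c' d x)" for f
  proof -
    have "length [0, i, 0, i] = 4" by simp
    then show ?thesis
      unfolding frame_comp_def
      by (simp only: sum_lists_length_4) (simp add: ctensor4_def numeral_eq_Suc lessThan_Suc mult_ac)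
  qed
  assume "\<not> ?thesis"
  then have "frame_comp ?T x e [0, i, 0, i] \<noteq> 0"
    by (simp add: fc e(2))
  \<comment> \<open>The two slots filled with \<open>e 0\<close> contribute one factor each;
    \<open>e i\<close> is fixed by the boost as \<open>i\<close> is 2 or 3.\<close>
  moreover have "has_boost_weight ?T x e [0, i, 0, i] 2"
    using i unfolding has_boost_weight_def fc boost_def
    by (auto simp: sum_distrib_left power2_eq_square mult_ac)
  ultimately have "ereal (of_int 2) \<le> boost_order 4 ?T x e"
    unfolding boost_order_def by (intro Sup_upper) (auto intro!: exI[of _ 2] exI[of _ "[0, i, 0, i]"])
  also have "\<dots> \<le> 1" using assms unfolding weyl_aligned_def by blast
  finally show False by simp
qed

text \<open>Symmetry is inherited from \<open>minkowski\<close> by solving the congruence for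
  \<open>M\<close>; invertibility follows by taking determinants in the congruence, as
  \<open>minkowski\<close> squares to the identity.\<close>

lemma lorentzian_form_invertible_sym:
  assumes "lorentzian_form M"
  shows "invertible M" "M $ a $ b = M $ b $ a"
proof -
  obtain P where P: "invertible P" "transpose P ** M ** P = minkowski"
    using assms unfolding lorentzian_form_def by blast
  have "(\<Sum>k\<in>UNIV. minkowski $ a $ k * F k) = (if a = 0 then - F a else F a)" for a F
  proof -
    have "(\<Sum>k\<in>UNIV. minkowski $ a $ k * F k) = (\<Sum>k\<in>UNIV. if a = k then (if a = 0 then - F a else F a) else 0)"
      by (rule sum.cong) (auto simp: minkowski_def)
    then show ?thesis by simp
  qed
  then have mm: "minkowski ** minkowski = mat 1"
    by (simp add: matrix_matrix_mult_def mat_def vec_eq_iff) (simp add: minkowski_def)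
  let ?Q = "matrix_inv P"
  have tQ: "transpose ?Q ** transpose P = mat 1"
    by (metis P(1) matrix_inv_right matrix_transpose_mul transpose_mat)
  have "transpose ?Q ** minkowski ** ?Q = (transpose ?Q ** transpose P) ** M ** (P ** ?Q)"
    unfolding P(2)[symmetric] by (simp only: matrix_mul_assoc)
  then have M: "M = transpose ?Q ** minkowski ** ?Q"
    by (simp add: tQ matrix_inv_right[OF P(1)])
  have "transpose minkowski = minkowski"
    by (simp add: minkowski_def transpose_def vec_eq_iff)
  then have "transpose M = M"
    by (subst (1 2) M) (simp add: matrix_transpose_mul matrix_mul_assoc)
  then show "M $ a $ b = M $ b $ a"
    by (metis (mono_tags, lifting) transpose_def vec_lambda_beta)
  have "det minkowski \<noteq> 0"
    using mm by (metis invertible_det_nz invertible_right_inverse)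
  then have "det M \<noteq> 0"
    using P(2) by (metis det_mul mult_eq_0_iff)
  then show "invertible M" by (simp add: invertible_det_nz)
qed

text \<open>The field equations reduce to 4 \<alpha> B = (\<gamma> + 8 \<beta> \<Lambda>) S. If both
  coefficients vanish, this holds identically and says nothing about the geometry; the second
  assumption excludes that case. The Kundt congruence is the given \<open>l\<close> itself.\<close>

theorem proposition1p1:
  fixes A :: "('p::{t2_space,second_countable_topology}) chart set"
    and g :: "'p chart \<Rightarrow> real^4 \<Rightarrow> real^4^4"
    and l :: "'p chart \<Rightarrow> real^4 \<Rightarrow> real^4"
    and \<omega> :: "'p \<Rightarrow> real"
    and \<alpha> \<beta> \<gamma> \<Lambda> :: real
  assumes "spacetime_4 A g"
    and "\<not> (\<alpha> = 0 \<and> \<gamma> + 8 * \<beta> * \<Lambda> = 0)"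
    and "quadratic_gravity_vacuum \<alpha> \<beta> \<gamma> \<Lambda> A g"
    and "null_vector_field A g l"
    and "smooth_scalar_field A \<omega>" and "\<And>p. \<omega> p \<noteq> 0"
    and "\<And>c x a b. c \<in> A \<Longrightarrow> x \<in> chart_image c \<Longrightarrow>
           ricci (g c) a b x = \<Lambda> * g c x $ a $ b
             + \<omega> (chart_inv c x) * lower (g c) (l c) a x * lower (g c) (l c) b x"
    and "weyl_aligned A g l"
  shows "kundt A g"
proof -
  have chart: "pure_radiation_chart (chart_image c) (g c) (l c) (\<lambda>x. \<omega> (chart_inv c x)) \<Lambda>" if c: "c \<in> A" for c
  proof
    show "open (chart_image c)"
      using assms(1) c unfolding spacetime_4_def smooth_4_manifold_def by blast
    show "smooth_on (chart_image c) (\<lambda>y. g c y $ a $ b)" for a b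
      using assms(1) c unfolding spacetime_4_def lorentzian_metric_def by blast
    have lor: "lorentzian_form (g c x)" if "x \<in> chart_image c" for x
      using assms(1) c that unfolding spacetime_4_def lorentzian_metric_def by blast
    show "g c x $ a $ b = g c x $ b $ a" "invertible (g c x)" if "x \<in> chart_image c" for x a b
      using lorentzian_form_invertible_sym[OF lor[OF that]] by blast+
    show "smooth_on (chart_image c) (\<lambda>y. l c y $ a)" for a
      using assms(4) c unfolding null_vector_field_def smooth_vector_field_def by blast
    show "smooth_on (chart_image c) (\<lambda>x. \<omega> (chart_inv c x))"
      using assms(5) c unfolding smooth_scalar_field_def by blast
    show "sprod (g c x) (l c x) (l c x) = 0" if "x \<in> chart_image c" for x
      using assms(4) c that unfolding null_vector_field_def by blast
  qed (use assms(6,7) c in auto)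
  have field: "4 * \<alpha> * bach (g c) a b x
      = (\<gamma> + 8 * \<beta> * \<Lambda>) * pure_radiation_chart.S (g c) (l c) (\<lambda>x. \<omega> (chart_inv c x)) a b x"
    if "c \<in> A" "x \<in> chart_image c" for c x a b
    using pure_radiation_chart.field_equation[OF chart[OF that(1)] that(2)] assms(3) that
    unfolding quadratic_gravity_vacuum_def by blast
  have optical: "optical_matrix (g c) (l c) e i j x = 0"
    if c: "c \<in> A" "x \<in> chart_image c" and e: "null_frame (g c x) e" "e 0 = l c x"
        and ij: "i \<in> {2, 3}" "j \<in> {2, 3}"
    for c x e i j
  proof -
    interpret pure_radiation_chart "chart_image c" "g c" "l c" "\<lambda>x. \<omega> (chart_inv c x)" \<Lambda>
      by (rule chart[OF c(1)])
    have "l c x \<noteq> 0"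
      using assms(4) c unfolding null_vector_field_def by blast
    \<comment> \<open>For this index S has the nonzero diagonal entry \<omega> times the square of
      \<open>L a x\<close>; with \<alpha> = 0 the reduced equation would force \<gamma> + 8 \<beta>
      \<Lambda> = 0.\<close>
    then obtain a where a: "L a x \<noteq> 0" using L_nonzero[OF c(2)] by blast
    then have "S a a x \<noteq> 0" using assms(6) by (simp add: S_def W_def)
    then have "\<alpha> \<noteq> 0" using field[OF c, of a a] assms(2) by auto
    then show ?thesis
      using optical_matrix_zero[OF c(2) e ij weyl_aligned_component[OF assms(8) c e ij(1)] field[OF c]]
      by simp
  qed
  have "geodetic A g l"
    unfolding geodetic_def cov_deriv_lower_def
    using pure_radiation_chart.geodetic_l[OF chart] by blast
  then show ?thesis
    unfolding kundt_def using assms(4) optical by blast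
qed

end
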